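(* Let $\gamma\subset\mathbb C$ be a real $1$-dimensional curve of class $C^\infty$. Then $\gamma$ is locally biholomorphically homogeneous if and only if $\gamma$ is real-analytic.
   Context: A real $1$-dimensional curve of class $C^\infty$ in $\mathbb C\cong\mathbb R^2$ is an (embedded, locally closed) $1$-dimensional $C^\infty$ submanifold of $\mathbb R^2$. It is real-analytic if it is a real-analytic submanifold of $\mathbb R^2$. A subset $K\subset\mathbb C$ is locally biholomorphically homogeneous if for any two points $p,q\in K$ there exist an open neighborhood $U$ of $p$ in $\mathbb C$ and a biholomorphism $\psi:U\to\psi(U)\subset\mathbb C$ such that $\psi(U\cap K)=K\cap\psi(U)$ and $\psi(p)=q$. *)

theory Defs
  imports "HOL-Complex_Analysis.Complex_Analysis"
begin

text \<open>The type \<^typ>\<open>complex\<close> serves both as the complex plane and as the real plane, and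
  the set \<open>\<real>\<close> of real numbers inside it is the first coordinate axis of the real plane.\<close>

subsection \<open>Regularity classes on open sets\<close>

primrec Ck_on :: "nat \<Rightarrow> 'a::real_normed_vector set \<Rightarrow> ('a \<Rightarrow> 'b::real_normed_vector) \<Rightarrow> bool" where
  "Ck_on 0 U f \<longleftrightarrow> continuous_on U f"
| "Ck_on (Suc k) U f \<longleftrightarrow> (\<forall>x\<in>U. f differentiable (at x)) \<and>
     (\<forall>v. Ck_on k U (\<lambda>x. frechet_derivative f (at x) v))"

text \<open>Derivatives are real Frechet derivatives; the notion is meant for open \<open>U\<close>.\<close>

definition smooth_on :: "'a::real_normed_vector set \<Rightarrow> ('a \<Rightarrow> 'b::real_normed_vector) \<Rightarrow> bool" where
  "smooth_on U f \<longleftrightarrow> (\<forall>k. Ck_on k U f)"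

text \<open>Real-analyticity of a map between subsets of the real plane: near every point it is the sum
  of a power series in the two real coordinates. The coefficients are vectors of the real plane,
  so both components of the map are expanded at once.\<close>

definition real_analytic_on :: "complex set \<Rightarrow> (complex \<Rightarrow> complex) \<Rightarrow> bool" where
  "real_analytic_on U f \<longleftrightarrow>
     (\<forall>p\<in>U. \<exists>r>0. \<exists>c :: nat \<Rightarrow> nat \<Rightarrow> complex. \<forall>z\<in>ball p r.
        ((\<lambda>(m, n). (Re (z - p) ^ m * Im (z - p) ^ n) *\<^sub>R c m n) has_sum f z) UNIV)"

subsection \<open>Isomorphisms between open sets\<close>

definition smooth_diffeomorphism :: "complex set \<Rightarrow> complex set \<Rightarrow> (complex \<Rightarrow> complex) \<Rightarrow> bool" where
  "smooth_diffeomorphism U V \<phi> \<longleftrightarrow> open U \<and> open V \<and> bij_betw \<phi> U V \<and>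
     smooth_on U \<phi> \<and> smooth_on V (inv_into U \<phi>)"

definition real_analytic_diffeomorphism ::
    "complex set \<Rightarrow> complex set \<Rightarrow> (complex \<Rightarrow> complex) \<Rightarrow> bool" where
  "real_analytic_diffeomorphism U V \<phi> \<longleftrightarrow> open U \<and> open V \<and> bij_betw \<phi> U V \<and>
     real_analytic_on U \<phi> \<and> real_analytic_on V (inv_into U \<phi>)"

definition biholomorphism :: "complex set \<Rightarrow> complex set \<Rightarrow> (complex \<Rightarrow> complex) \<Rightarrow> bool" where
  "biholomorphism U V \<psi> \<longleftrightarrow> open U \<and> open V \<and> bij_betw \<psi> U V \<and>
     \<psi> holomorphic_on U \<and> inv_into U \<psi> holomorphic_on V"

subsection \<open>Curves and local homogeneity\<close>

text \<open>Embedded one-dimensional submanifolds of the plane, given by slice charts: ambient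
  coordinates straightening the curve to the first axis. Such a set is automatically locally
  closed; it need not be closed or connected.\<close>

definition smooth_curve :: "complex set \<Rightarrow> bool" where
  "smooth_curve \<gamma> \<longleftrightarrow>
     (\<forall>p\<in>\<gamma>. \<exists>U V \<phi>. p \<in> U \<and> smooth_diffeomorphism U V \<phi> \<and> \<phi> ` (U \<inter> \<gamma>) = V \<inter> \<real>)"

definition real_analytic_curve :: "complex set \<Rightarrow> bool" where
  "real_analytic_curve \<gamma> \<longleftrightarrow>
     (\<forall>p\<in>\<gamma>. \<exists>U V \<phi>. p \<in> U \<and> real_analytic_diffeomorphism U V \<phi> \<and> \<phi> ` (U \<inter> \<gamma>) = V \<inter> \<real>)"

definition locally_biholomorphically_homogeneous :: "complex set \<Rightarrow> bool" where
  "locally_biholomorphically_homogeneous K \<longleftrightarrow>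
     (\<forall>p\<in>K. \<forall>q\<in>K. \<exists>U \<psi>. p \<in> U \<and> biholomorphism U (\<psi> ` U) \<psi> \<and>
        \<psi> ` (U \<inter> K) = K \<inter> \<psi> ` U \<and> \<psi> p = q)"

end

(* Real-analyticity at a point means that a local biholomorphism takes the curve to the real axis, and
   by homogeneity it is enough to find one such point. It exists as soon as a holomorphic \<Psi> with
   \<Psi>(p) \<noteq> 0 makes \<Psi> dz real along the curve near p, for a primitive of \<Psi> then straightens the curve.

   Suppose there is no such point. A germ of the curve fixing p multiplies the tangent at p by a real
   number m. If |m| < 1, the normalized derivatives (g^n)'/m^n of the iterates have a limit \<Psi> as above,
   since all points near p are contracted to p, where the tangent is fixed; if |m| > 1, use the inverse.
   So |m| = 1, and the modulus \<nu>(q) of the multiplier of a germ from a base point to q depends only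
   on q. By Baire and Montel, the points q of some arc are reached by univalent maps on a common disc
   with a common bound, so \<nu> is continuous and |dq|/\<nu> is a metric on the arc invariant under germs.
   In its arc length parameter the germs are translations T_v. The average Z of the T_v over
   0 \<le> v \<le> \<delta> is holomorphic, and (T_\<delta> - id)/(\<delta> Z') is a nonvanishing holomorphic vector field
   tangent to the curve; its reciprocal is a \<Psi> as above, a contradiction. *)

theory Submission
  imports Defs
begin

subsection \<open>Straightening maps\<close>

text \<open>Homogeneity yields, for each pair of points, some germ with no control of its domain,
  its size or its dependence on the points; all uniformity has to come from compactness of families
  of univalent maps with fixed bounds. Points without a straightening turn the arbitrary choice of
  germs into a function: two germs with the same endpoints differ by an isotropy germ, whose
  multiplier has modulus 1. The sign of the multiplier stays undetermined, so the orientation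
  becomes part of the index in the Baire argument. Multipliers are measured against the velocity
  \<open>c'\<close>, which makes them real also between different points. The maps T_v come from a
  choice made separately for each v, so off the curve nothing is known about their dependence on v;
  integrating over v and then differentiating along the curve takes the place of a derivative in
  v.\<close>

text \<open>The map runs from the disc into the plane, opposite to a slice chart, so that the power
  series of a parametrization can serve as it is. Equality instead of inclusion excludes further
  points of the curve in the image.\<close>

definition straight :: "complex set \<Rightarrow> complex \<Rightarrow> bool" where
  "straight \<gamma> p \<longleftrightarrow> (\<exists>f r. r > 0 \<and> f holomorphic_on ball 0 r \<and> inj_on f (ball 0 r) \<and> f 0 = p \<and>
     f ` (ball 0 r \<inter> \<real>) = \<gamma> \<inter> f ` ball 0 r)"

text \<open>Injectivity preserves the equality of sets when the disc shrinks. Small radii are needed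
  to put two straightening maps on the same disc.\<close>

lemma straightE:
  assumes "straight \<gamma> p" "e > 0"
  obtains f r where "0 < r" "r \<le> e" "f holomorphic_on ball 0 r" "inj_on f (ball 0 r)" "f 0 = p"
    "f ` (ball 0 r \<inter> \<real>) = \<gamma> \<inter> f ` ball 0 r"
proof -
  obtain f r where f: "r > 0" "f holomorphic_on ball 0 r" "inj_on f (ball 0 r)" "f 0 = p"
    "f ` (ball 0 r \<inter> \<real>) = \<gamma> \<inter> f ` ball 0 r"
    using assms(1) unfolding straight_def by auto
  define s where "s = min r e"
  have sub: "ball 0 s \<subseteq> ball (0::complex) r" by (auto simp: s_def)
  have "f ` (ball 0 s \<inter> \<real>) = \<gamma> \<inter> f ` ball 0 s"
  proof (intro equalityI subsetI)
    fix y assume "y \<in> f ` (ball 0 s \<inter> \<real>)"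
    then show "y \<in> \<gamma> \<inter> f ` ball 0 s" using f(5) sub by blast
  next
    fix y assume y: "y \<in> \<gamma> \<inter> f ` ball 0 s"
    then obtain z where z: "z \<in> ball 0 s" "y = f z" by auto
    then have "y \<in> f ` (ball 0 r \<inter> \<real>)" using f(5) y sub by blast
    then obtain x where x: "x \<in> ball 0 r" "x \<in> \<real>" "y = f x" by auto
    then have "x = z" using z f(3) sub by (metis inj_onD subsetD)
    then show "y \<in> f ` (ball 0 s \<inter> \<real>)" using z x by auto
  qed
  then show ?thesis
    using that[of s f] f assms(2) sub by (auto simp: s_def intro: holomorphic_on_subset inj_on_subset)
qed

lemma biholomorphism_image:
  assumes "open S" "f holomorphic_on S" "inj_on f S"
  shows "biholomorphism S (f ` S) f"
proof -
  obtain g where g: "g holomorphic_on f ` S" "\<And>z. z \<in> S \<Longrightarrow> g (f z) = z"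
    using holomorphic_has_inverse[of f S] assms by metis
  have "inv_into S f holomorphic_on f ` S"
    using holomorphic_transform[OF g(1)] g(2) assms(3) by (metis (no_types, lifting) image_iff inv_into_f_f)
  then show ?thesis
    using assms by (simp add: biholomorphism_def open_mapping_thm3 inj_on_imp_bij_betw)
qed

text \<open>The symmetry is composed with the straightening map. This spreads straightness from one
  point to all points that symmetries reach.\<close>

lemma straight_image:
  assumes "straight \<gamma> p" "p \<in> U" "biholomorphism U (\<psi> ` U) \<psi>" "\<psi> ` (U \<inter> \<gamma>) = \<gamma> \<inter> \<psi> ` U"
  shows "straight \<gamma> (\<psi> p)"
proof -
  have U: "open U" "\<psi> holomorphic_on U" "inj_on \<psi> U"
    using assms(3) by (auto simp: biholomorphism_def bij_betw_def)
  obtain f2 r2 where f2: "0 < r2" "f2 holomorphic_on ball 0 r2" "inj_on f2 (ball 0 r2)" "f2 0 = p"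
    "f2 ` (ball 0 r2 \<inter> \<real>) = \<gamma> \<inter> f2 ` ball 0 r2"
    using straightE[OF assms(1), of 1] by (metis zero_less_one)
  have "open (ball 0 r2 \<inter> f2 -` U)"
    using f2(2) U(1) by (intro continuous_open_preimage holomorphic_on_imp_continuous_on) auto
  moreover have "0 \<in> ball 0 r2 \<inter> f2 -` U" using f2 assms(2) by auto
  ultimately obtain e where e: "e > 0" "ball 0 e \<subseteq> ball 0 r2 \<inter> f2 -` U"
    by (meson open_contains_ball)
  have sub: "ball 0 e \<subseteq> ball (0::complex) r2" "f2 ` ball 0 e \<subseteq> U" using e(2) by blast+
  have "(\<psi> \<circ> f2) ` (ball 0 e \<inter> \<real>) = \<gamma> \<inter> (\<psi> \<circ> f2) ` ball 0 e"
  proof (intro equalityI subsetI)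
    fix y assume "y \<in> (\<psi> \<circ> f2) ` (ball 0 e \<inter> \<real>)"
    then obtain z where z: "z \<in> ball 0 e" "z \<in> \<real>" "y = \<psi> (f2 z)" by auto
    then have "z \<in> ball 0 r2" "f2 z \<in> U" using sub by auto
    then have "f2 z \<in> U \<inter> \<gamma>" using f2(5) z by blast
    then show "y \<in> \<gamma> \<inter> (\<psi> \<circ> f2) ` ball 0 e" using z assms(4) by auto
  next
    fix y assume y: "y \<in> \<gamma> \<inter> (\<psi> \<circ> f2) ` ball 0 e"
    then obtain z where z: "z \<in> ball 0 e" "y = \<psi> (f2 z)" by auto
    then have "f2 z \<in> U" using sub by auto
    then have "y \<in> \<psi> ` (U \<inter> \<gamma>)" unfolding assms(4) using y z by auto
    then obtain u where u: "u \<in> U" "u \<in> \<gamma>" "y = \<psi> u" by auto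
    have "u = f2 z" using u z \<open>f2 z \<in> U\<close> inj_onD[OF U(3), of u "f2 z"] by simp
    moreover have zr: "z \<in> ball 0 r2" using z sub by blast
    ultimately have "f2 z \<in> f2 ` (ball 0 r2 \<inter> \<real>)" unfolding f2(5) using u by auto
    then obtain x where x: "x \<in> ball 0 r2" "x \<in> \<real>" "f2 z = f2 x" by auto
    then have "z \<in> \<real>" using zr inj_onD[OF f2(3), of z x] by simp
    then show "y \<in> (\<psi> \<circ> f2) ` (ball 0 e \<inter> \<real>)" using z by auto
  qed
  moreover have "(\<psi> \<circ> f2) holomorphic_on ball 0 e"
    using f2(2) U(2) sub by (meson holomorphic_on_compose_gen holomorphic_on_subset)
  moreover have "inj_on (\<psi> \<circ> f2) (ball 0 e)"
    using f2(3) U(3) sub by (meson comp_inj_on inj_on_subset)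
  ultimately show ?thesis
    unfolding straight_def using e f2(4) by (intro exI[of _ "\<psi> \<circ> f2"] exI[of _ e]) auto
qed

text \<open>If \<open>f0\<close> and \<open>g\<close> straighten the curve at p and q on the same
  disc, then \<open>g\<close> after the inverse of \<open>f0\<close> is the required symmetry, since
  both carry the real diameter onto the curve.\<close>

lemma straight_imp_homogeneous:
  assumes "\<And>p. p \<in> \<gamma> \<Longrightarrow> straight \<gamma> p"
  shows "locally_biholomorphically_homogeneous \<gamma>"
  unfolding locally_biholomorphically_homogeneous_def
proof (intro ballI)
  fix p q assume "p \<in> \<gamma>" "q \<in> \<gamma>"
  then have st: "straight \<gamma> p" "straight \<gamma> q" using assms by auto
  obtain f0 r0 where f0: "0 < r0" "r0 \<le> 1" "f0 holomorphic_on ball 0 r0" "inj_on f0 (ball 0 r0)"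
    "f0 0 = p" "f0 ` (ball 0 r0 \<inter> \<real>) = \<gamma> \<inter> f0 ` ball 0 r0"
    using straightE[OF st(1), of 1] by (metis zero_less_one)
  obtain g s where g: "0 < s" "s \<le> r0" "g holomorphic_on ball 0 s" "inj_on g (ball 0 s)"
    "g 0 = q" "g ` (ball 0 s \<inter> \<real>) = \<gamma> \<inter> g ` ball 0 s"
    using straightE[OF st(2) f0(1)] by metis
  have sub: "ball 0 s \<subseteq> ball (0::complex) r0" using g by auto
  have f: "f0 holomorphic_on ball 0 s" "inj_on f0 (ball 0 s)"
    using f0 sub by (auto intro: holomorphic_on_subset inj_on_subset)
  define U where "U = f0 ` ball 0 s"
  have bi: "biholomorphism (ball 0 s) U f0"
    unfolding U_def using f by (intro biholomorphism_image) auto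
  define h where "h = inv_into (ball 0 s) f0"
  have h: "h holomorphic_on U" "open U" "inj_on h U" "h ` U = ball 0 s"
    using bi unfolding biholomorphism_def h_def
    by (auto simp: bij_betw_def inj_on_inv_into inv_into_image_cancel)
  have hf: "h (f0 z) = z" if "z \<in> ball 0 s" for z using that f(2) by (simp add: h_def)
  have "biholomorphism U ((g \<circ> h) ` U) (g \<circ> h)"
    using h g by (intro biholomorphism_image holomorphic_on_compose_gen[of h U g "ball 0 s"] comp_inj_on) auto
  moreover have "(g \<circ> h) ` (U \<inter> \<gamma>) = \<gamma> \<inter> (g \<circ> h) ` U"
  proof -
    have "U \<inter> \<gamma> = f0 ` (ball 0 s \<inter> \<real>)"
      using f0(4,6) sub unfolding U_def inj_on_def by blast
    then have "h ` (U \<inter> \<gamma>) = ball 0 s \<inter> \<real>" using hf by (force simp: image_iff)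
    then show ?thesis using g(6) h(4) by (metis image_comp)
  qed
  moreover have "p \<in> U" "(g \<circ> h) p = q" using f0(5) g(1,5) hf[of 0] by (auto simp: U_def)
  ultimately show "\<exists>U \<psi>. p \<in> U \<and> biholomorphism U (\<psi> ` U) \<psi> \<and>
        \<psi> ` (U \<inter> \<gamma>) = \<gamma> \<inter> \<psi> ` U \<and> \<psi> p = q" by blast
qed

section \<open>Passage between holomorphic and real-analytic maps\<close>

lemma bij_betw_add_pairs: "bij_betw (\<lambda>(k, m). (m, k - m)) (Sigma UNIV (\<lambda>k. {..k})) (UNIV :: (nat \<times> nat) set)"
  by (rule bij_betwI[where g = "\<lambda>(m, n). (m + n, m)"]) auto

text \<open>The Taylor series is expanded by the binomial theorem and regrouped by the two
  exponents. Regrouping needs absolute convergence of the double series, that is, of the Taylor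
  series at |x| + |y|; half the radius guarantees |x| + |y| < R.\<close>

lemma holomorphic_imp_real_analytic:
  assumes "open U" "f holomorphic_on U"
  shows "real_analytic_on U f"
  unfolding real_analytic_on_def
proof
  fix p assume "p \<in> U"
  then obtain R where R: "R > 0" "ball p R \<subseteq> U" using assms(1) by (meson open_contains_ball)
  define a where "a k = (deriv ^^ k) f p / fact k" for k
  have sums: "(\<lambda>k. a k * (w - p) ^ k) sums f w" if "w \<in> ball p R" for w
    unfolding a_def using holomorphic_power_series[of f p R w] that R assms(2)
    by (auto intro: holomorphic_on_subset)
  define c where "c m n = a (m + n) * (of_nat ((m + n) choose m) * \<i> ^ n)" for m n
  have "((\<lambda>(m, n). (Re (z - p) ^ m * Im (z - p) ^ n) *\<^sub>R c m n) has_sum f z) UNIV"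
    if z: "z \<in> ball p (R/2)" for z
  proof -
    define x y where "x = Re (z - p)" and "y = Im (z - p)"
    define F where "F = (\<lambda>(k, m). a k * (of_nat (k choose m) * of_real x ^ m * (\<i> * of_real y) ^ (k - m)))"
    have zp: "z - p = of_real x + \<i> * of_real y"
      by (simp add: x_def y_def complex_eq_iff)
    have xy: "\<bar>x\<bar> + \<bar>y\<bar> < R"
      using z abs_Re_le_cmod[of "z - p"] abs_Im_le_cmod[of "z - p"]
      by (auto simp: x_def y_def dist_norm norm_minus_commute)
    have inner: "(\<lambda>m. norm (F (k, m))) summable_on {..k}" for k by simp
    have innersum: "((\<lambda>m. F (k, m)) has_sum a k * (z - p) ^ k) {..k}" for k
    proof -
      have "(\<Sum>m\<le>k. F (k, m)) = a k * (z - p) ^ k"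
        unfolding zp binomial_ring F_def by (simp add: sum_distrib_left)
      then show ?thesis by (metis finite_atMost has_sum_finite)
    qed
    have innernorm: "infsum (\<lambda>m. norm (F (k, m))) {..k} = norm (a k) * (\<bar>x\<bar> + \<bar>y\<bar>) ^ k" for k
      unfolding binomial_ring F_def
      by (simp add: sum_distrib_left norm_mult norm_power)
    have "summable (\<lambda>k. norm (a k * (of_real (\<bar>x\<bar> + \<bar>y\<bar>)) ^ k))"
    proof (rule powser_insidea)
      \<comment> \<open>A point of convergence strictly between |x| + |y| and R gives absolute
        convergence at |x| + |y|.\<close>
      show "summable (\<lambda>k. a k * (of_real ((\<bar>x\<bar> + \<bar>y\<bar> + R)/2)) ^ k)"
      proof -
        define t where "t = (\<bar>x\<bar> + \<bar>y\<bar> + R)/2"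
        have "0 \<le> t" "t < R" using xy by (auto simp: t_def)
        then show ?thesis
          using sums[of "p + of_real t"] by (simp add: sums_iff dist_norm t_def[symmetric])
      qed
      show "norm (complex_of_real (\<bar>x\<bar> + \<bar>y\<bar>)) < norm (complex_of_real ((\<bar>x\<bar> + \<bar>y\<bar> + R)/2))"
      proof -
        have "norm (complex_of_real a) = a" if "a \<ge> 0" for a using that by simp
        from this[of "\<bar>x\<bar> + \<bar>y\<bar>"] this[of "(\<bar>x\<bar> + \<bar>y\<bar> + R)/2"] show ?thesis
          using xy R by (simp del: of_real_add of_real_divide norm_of_real)
      qed
    qed
    then have sumk: "(\<lambda>k. norm (a k) * (\<bar>x\<bar> + \<bar>y\<bar>) ^ k) summable_on UNIV"
      by (intro summable_nonneg_imp_summable_on) (auto simp: norm_mult norm_power simp del: of_real_add)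
    have "(\<lambda>s. norm (F s)) summable_on Sigma UNIV (\<lambda>k. {..k})"
      unfolding Infinite_Sum.abs_summable_on_Sigma_iff innernorm 
    proof (intro conjI ballI)
      show "(\<lambda>k. norm (norm (a k) * (\<bar>x\<bar> + \<bar>y\<bar>) ^ k)) summable_on UNIV"
        using sumk by (simp add: abs_mult)
    qed (use inner in auto)
    then have "F summable_on Sigma UNIV (\<lambda>k. {..k})" by (rule abs_summable_summable)
    moreover have "((\<lambda>k. a k * (z - p) ^ k) has_sum f z) UNIV"
    proof (rule norm_summable_imp_has_sum)
      have "z \<in> ball p R" using z R by auto
      then show "(\<lambda>k. a k * (z - p) ^ k) sums f z" by (rule sums)
      have "summable (\<lambda>k. norm (a k) * (\<bar>x\<bar> + \<bar>y\<bar>) ^ k)"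
        using \<open>summable (\<lambda>k. norm (a k * (of_real (\<bar>x\<bar> + \<bar>y\<bar>)) ^ k))\<close>
        by (simp add: norm_mult norm_power del: of_real_add)
      then show "summable (\<lambda>k. norm (a k * (z - p) ^ k))"
      proof (rule summable_comparison_test'[where N = 0], goal_cases)
        case (1 n)
        have "norm (z - p) \<le> \<bar>x\<bar> + \<bar>y\<bar>" unfolding x_def y_def by (rule cmod_le)
        then show ?case by (auto simp: norm_mult norm_power intro!: mult_left_mono power_mono)
      qed
    qed
    ultimately have "(F has_sum f z) (Sigma UNIV (\<lambda>k. {..k}))"
      using has_sum_SigmaI[where A = UNIV and B = "\<lambda>k. {..k}" and f = F and g = "\<lambda>k. a k * (z - p) ^ k"] innersum by blast
    moreover have "F s = (\<lambda>(m, n). (x ^ m * y ^ n) *\<^sub>R c m n) ((\<lambda>(k, m). (m, k - m)) s)"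
      if "s \<in> Sigma UNIV (\<lambda>k. {..k})" for s
      using that by (auto simp: F_def c_def scaleR_conv_of_real power_mult_distrib algebra_simps)
    ultimately have "((\<lambda>s. (\<lambda>(m, n). (x ^ m * y ^ n) *\<^sub>R c m n) ((\<lambda>(k, m). (m, k - m)) s)) has_sum f z)
        (Sigma UNIV (\<lambda>k. {..k}))"
      by (subst has_sum_cong[symmetric]) auto
    then show ?thesis
      unfolding x_def y_def
      by (subst has_sum_reindex_bij_betw[OF bij_betw_add_pairs, symmetric])
  qed
  then show "\<exists>r>0. \<exists>c :: nat \<Rightarrow> nat \<Rightarrow> complex. \<forall>z\<in>ball p r.
        ((\<lambda>(m, n). (Re (z - p) ^ m * Im (z - p) ^ n) *\<^sub>R c m n) has_sum f z) UNIV"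
    using R(1) by (intro exI[of _ "R/2"] conjI exI[of _ c] ballI) auto
qed

lemma straight_imp_real_analytic_curve:
  assumes "\<And>p. p \<in> \<gamma> \<Longrightarrow> straight \<gamma> p"
  shows "real_analytic_curve \<gamma>"
  unfolding real_analytic_curve_def
proof
  fix p assume "p \<in> \<gamma>"
  then obtain f r where f: "r > 0" "f holomorphic_on ball 0 r" "inj_on f (ball 0 r)" "f 0 = p"
    "f ` (ball 0 r \<inter> \<real>) = \<gamma> \<inter> f ` ball 0 r"
    using assms unfolding straight_def by metis
  define U where "U = f ` ball 0 r"
  define \<phi> where "\<phi> = inv_into (ball 0 r) f"
  have bi: "open U" "\<phi> holomorphic_on U"
    using biholomorphism_image[OF open_ball f(2,3)] unfolding biholomorphism_def U_def \<phi>_def by auto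
  have \<phi>f: "\<phi> (f z) = z" if "z \<in> ball 0 r" for z using that f(3) by (simp add: \<phi>_def)
  have bij: "bij_betw \<phi> U (ball 0 r)" unfolding U_def \<phi>_def
    by (simp add: bij_betw_inv_into f(3) inj_on_imp_bij_betw)
  have inv: "inv_into U \<phi> z = f z" if "z \<in> ball 0 r" for z
    using that bij \<phi>f by (metis U_def bij_betw_inv_into_left imageI)
  have "inv_into U \<phi> holomorphic_on ball 0 r"
    using holomorphic_transform[OF f(2)] inv by metis
  then have "real_analytic_diffeomorphism U (ball 0 r) \<phi>"
    unfolding real_analytic_diffeomorphism_def using bi bij by (auto intro: holomorphic_imp_real_analytic)
  moreover have "\<phi> ` (U \<inter> \<gamma>) = ball 0 r \<inter> \<real>"
  proof -
    have "U \<inter> \<gamma> = f ` (ball 0 r \<inter> \<real>)" using f(5) by (auto simp: U_def)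
    then show ?thesis using \<phi>f by (force simp: image_iff)
  qed
  moreover have "p \<in> U" using f by (auto simp: U_def)
  ultimately show "\<exists>U V \<phi>. p \<in> U \<and> real_analytic_diffeomorphism U V \<phi> \<and> \<phi> ` (U \<inter> \<gamma>) = V \<inter> \<real>"
    by blast
qed

text \<open>All terms are compared with those at the diagonal point \<open>z1\<close>: a term of
  positive degree shrinks by at least the factor \<open>t\<close>, and the constant terms cancel.
  The summand 1 in the final constant only makes it positive.\<close>

lemma real_analytic_Lipschitz_at:
  fixes c :: "nat \<Rightarrow> nat \<Rightarrow> complex"
  assumes "r > 0" and H: "\<And>z. z \<in> ball p r \<Longrightarrow>
      ((\<lambda>(m, n). (Re (z - p) ^ m * Im (z - p) ^ n) *\<^sub>R c m n) has_sum f z) UNIV"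
  obtains C \<rho> where "C > 0" "\<rho> > 0" "\<And>z. z \<in> ball p \<rho> \<Longrightarrow> norm (f z - f p) \<le> C * norm (z - p)"
proof -
  \<comment> \<open>The point with both coordinates \<open>\<rho>\<close> has modulus sqrt 2 *
    \<open>\<rho>\<close>, which must stay below r.\<close>
  define \<rho> where "\<rho> = r / 2"
  have \<rho>: "\<rho> > 0" using assms(1) by (simp add: \<rho>_def)
  define T where "T z = (\<lambda>(m, n). (Re (z - p) ^ m * Im (z - p) ^ n) *\<^sub>R c m n)" for z
  define z1 where "z1 = p + Complex \<rho> \<rho>"
  have "norm (Complex \<rho> \<rho>) < r"
  proof -
    have "sqrt (\<rho>\<^sup>2 + \<rho>\<^sup>2) < sqrt ((2 * \<rho>)\<^sup>2)"
      using \<rho> by (intro real_sqrt_less_mono) (simp add: power2_eq_square)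
    then show ?thesis using \<rho> by (simp add: cmod_def \<rho>_def)
  qed
  then have "z1 \<in> ball p r" by (simp add: z1_def dist_norm)
  then have "(T z1 has_sum f z1) UNIV" unfolding T_def by (rule H)
  then have "T z1 summable_on UNIV" by (auto simp: summable_on_def)
  then have "(\<lambda>s. norm (T z1 s)) summable_on UNIV"
    by (simp add: summable_on_iff_abs_summable_on_complex)
  then obtain M where M: "((\<lambda>s. norm (T z1 s)) has_sum M) UNIV" by (auto simp: summable_on_def)
  have "M \<ge> 0" using M by (rule has_sum_nonneg) auto
  have Tz1: "norm (T z1 (m, n)) = \<rho> ^ (m + n) * norm (c m n)" for m n
    using \<rho> by (simp add: T_def z1_def abs_mult power_abs power_add)
  have bound: "norm (f z - f p) \<le> (M / \<rho> + 1) * norm (z - p)" if z: "z \<in> ball p \<rho>" for z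
  proof -
    define t where "t = norm (z - p) / \<rho>"
    have t: "0 \<le> t" "t \<le> 1" using z \<rho> by (auto simp: t_def dist_norm norm_minus_commute)
    have "(T z has_sum f z) UNIV" "(T p has_sum f p) UNIV"
      unfolding T_def by (rule H; use z assms(1) in \<open>simp add: \<rho>_def\<close>)+
    then have "((\<lambda>s. T z s + - T p s) has_sum (f z + - f p)) UNIV"
      by (intro has_sum_add) (simp_all add: has_sum_uminus)
    then have "((\<lambda>s. T z s - T p s) has_sum (f z - f p)) UNIV" by simp
    moreover have "((\<lambda>s. t * norm (T z1 s)) has_sum (t * M)) UNIV"
      using M by (rule has_sum_cmult_right)
    moreover have "norm (T z s - T p s) \<le> t * norm (T z1 s)" for s
    proof (cases s)
      case (Pair m n)
      show ?thesis
      proof (cases "m + n = 0")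
        case True
        then show ?thesis using t by (simp add: Pair T_def)
      next
        case False
        then have "T p s = 0" by (auto simp: Pair T_def)
        have "\<bar>Re (z - p)\<bar> ^ m * \<bar>Im (z - p)\<bar> ^ n \<le> (t * \<rho>) ^ m * (t * \<rho>) ^ n"
          using abs_Re_le_cmod[of "z - p"] abs_Im_le_cmod[of "z - p"] \<rho> t
          by (intro mult_mono power_mono) (auto simp: t_def)
        also have "\<dots> = t ^ (m + n) * \<rho> ^ (m + n)" by (simp add: power_mult_distrib power_add)
        also have "\<dots> \<le> t * \<rho> ^ (m + n)"
          using t \<rho> False power_decreasing[of 1 "m + n" t] by (intro mult_right_mono) auto
        finally have "norm (T z s) \<le> t * \<rho> ^ (m + n) * norm (c m n)"
          by (auto simp: Pair T_def abs_mult power_abs intro!: mult_right_mono)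
        then show ?thesis using \<open>T p s = 0\<close> Tz1 by (simp add: Pair mult.assoc)
      qed
    qed
    ultimately have "norm (f z - f p) \<le> t * M"
      using norm_infsum_le[where f = "\<lambda>s. T z s - T p s" and X = UNIV and g = "\<lambda>s. t * norm (T z1 s)"]
      by blast
    also have "\<dots> \<le> (M / \<rho> + 1) * norm (z - p)" by (simp add: t_def algebra_simps)
    finally show ?thesis .
  qed
  show ?thesis
    by (rule that[of "M / \<rho> + 1" \<rho>]) (use \<rho> \<open>M \<ge> 0\<close> bound in \<open>auto intro: add_nonneg_pos\<close>)
qed

text \<open>A real-analytic chart inverse, restricted to the real axis, is a power series in one real
  variable; the same series in a complex variable is the straightening map. Its derivative is
  nonzero because the chart is Lipschitz at the point.\<close>

lemma real_analytic_curve_imp_straight: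
  assumes "real_analytic_curve \<gamma>" "p \<in> \<gamma>"
  shows "straight \<gamma> p"
proof -
  obtain U V \<phi> where pU: "p \<in> U" and dif: "real_analytic_diffeomorphism U V \<phi>"
    and img: "\<phi> ` (U \<inter> \<gamma>) = V \<inter> \<real>"
    using assms unfolding real_analytic_curve_def by blast
  have UV: "open U" "open V" "bij_betw \<phi> U V" "real_analytic_on U \<phi>" "real_analytic_on V (inv_into U \<phi>)"
    using dif by (auto simp: real_analytic_diffeomorphism_def)
  define g where "g = inv_into U \<phi>"
  have g\<phi>: "g (\<phi> z) = z" if "z \<in> U" for z using that UV(3) by (simp add: g_def bij_betw_inv_into_left)
  have gV: "g w \<in> U" "\<phi> (g w) = w" if "w \<in> V" for w
    using that UV(3) by (auto simp: g_def bij_betw_inv_into_right) (metis bij_betw_def inv_into_into)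
  have "\<phi> p \<in> V \<inter> \<real>" using img pU assms(2) by blast
  then obtain t where t: "\<phi> p = of_real t" and tV: "\<phi> p \<in> V" by (auto elim: Reals_cases)
  obtain r c where r: "r > 0" and c: "\<And>z. z \<in> ball (\<phi> p) r \<Longrightarrow>
      ((\<lambda>(m, n). (Re (z - \<phi> p) ^ m * Im (z - \<phi> p) ^ n) *\<^sub>R c m n) has_sum g z) UNIV"
    using UV(5) tV unfolding real_analytic_on_def g_def[symmetric] by blast
  obtain r' c' where r': "r' > 0" and c': "\<And>z. z \<in> ball p r' \<Longrightarrow>
      ((\<lambda>(m, n). (Re (z - p) ^ m * Im (z - p) ^ n) *\<^sub>R c' m n) has_sum \<phi> z) UNIV"
    using UV(4) pU unfolding real_analytic_on_def by blast
  obtain C \<rho> where C: "C > 0" "\<rho> > 0" and Lip: "\<And>z. z \<in> ball p \<rho> \<Longrightarrow> norm (\<phi> z - \<phi> p) \<le> C * norm (z - p)"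
    using real_analytic_Lipschitz_at[OF r' c'] by metis
  define F where "F z = (\<Sum>m. c m 0 * z ^ m)" for z
  have real: "(\<lambda>m. c m 0 * of_real x ^ m) sums g (\<phi> p + of_real x)" if x: "\<bar>x\<bar> < r" for x
  proof -
    have "\<phi> p + of_real x \<in> ball (\<phi> p) r" using x by (simp add: dist_norm)
    from c[OF this] have "((\<lambda>(m, n). (x ^ m * 0 ^ n) *\<^sub>R c m n) has_sum g (\<phi> p + of_real x)) UNIV"
      by simp
    \<comment> \<open>On the axis only the terms with n = 0 survive, since 0 ^ 0 = 1 and all higher
      powers of 0 vanish.\<close>
    also have "?this \<longleftrightarrow> ((\<lambda>(m, n). (x ^ m) *\<^sub>R c m n) has_sum g (\<phi> p + of_real x)) (range (\<lambda>m. (m, 0)))"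
      by (rule has_sum_cong_neutral) (auto simp: image_iff)
    also have "\<dots> \<longleftrightarrow> ((\<lambda>m. x ^ m *\<^sub>R c m 0) has_sum g (\<phi> p + of_real x)) UNIV"
      by (subst has_sum_reindex) (auto simp: inj_on_def o_def)
    finally have "(\<lambda>m. x ^ m *\<^sub>R c m 0) sums g (\<phi> p + of_real x)" by (rule has_sum_imp_sums)
    then show ?thesis by (simp add: scaleR_conv_of_real mult.commute)
  qed
  have Freal: "F (of_real x) = g (\<phi> p + of_real x)" if "\<bar>x\<bar> < r" for x
    using real[OF that] by (simp add: F_def sums_iff)
  have F0: "F 0 = p" using Freal[of 0] r g\<phi> pU by simp
  have Fsums: "(\<lambda>m. c m 0 * (z - 0) ^ m) sums F z" if "z \<in> ball 0 r" for z
  proof -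
    \<comment> \<open>Convergence at the real point x gives convergence in the whole open disc of
      radius x.\<close>
    obtain x where x: "norm z < x" "x < r" using \<open>z \<in> ball 0 r\<close> dense by auto
    then have sx: "summable (\<lambda>m. c m 0 * of_real x ^ m)" "norm z < norm (complex_of_real x)"
      using real[of x] norm_ge_zero[of z] by (auto simp: sums_iff simp del: norm_ge_zero)
    show ?thesis unfolding F_def diff_zero by (rule summable_sums[OF powser_inside[OF sx]])
  qed
  then have Fhol: "F holomorphic_on ball 0 r" by (rule power_series_holomorphic)
  then have Fder: "(F has_field_derivative deriv F 0) (at 0)"
    using r by (intro holomorphic_derivI[of F "ball 0 r"]) auto
  have Fcont: "isCont F 0" using Fder by (rule DERIV_isCont)
  obtain e1 where e1: "e1 > 0" "ball (\<phi> p) e1 \<subseteq> V" using UV(2) tV by (meson open_contains_ball)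
  \<comment> \<open>With F' = 0 at 0, a small real x would be moved from p by at most x / (2 * C),
    while the Lipschitz bound of the chart makes the coordinate x at most C times that displacement,
    which is x / 2.\<close>
  have "deriv F 0 \<noteq> 0"
  proof
    assume "deriv F 0 = 0"
    then have "(F has_derivative (\<lambda>h. 0)) (at 0)" using Fder
      by (simp add: has_field_derivative_def lambda_zero)
    then obtain d where d: "d > 0" "\<And>z. norm z < d \<Longrightarrow> norm (F z - F 0) \<le> 1 / (2 * C) * norm z"
      using C(1) unfolding has_derivative_at_alt by (auto dest!: spec[of _ "1 / (2 * C)"])
    obtain d' where d': "d' > 0" "\<And>z. norm z < d' \<Longrightarrow> F z \<in> ball p \<rho>"
      using Fcont C(2) unfolding continuous_at_eps_delta F0 by (auto simp: dist_commute)
    define x where "x = Min {d, d', r, e1} / 2"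
    have x: "x > 0" "x < d" "x < d'" "x < r" "x < e1"
      using d(1) d'(1) r e1(1) by (auto simp: x_def)
    have xV: "\<phi> p + of_real x \<in> V" using x e1 by (auto simp: dist_norm)
    have "x = norm (\<phi> (F (of_real x)) - \<phi> p)"
      using Freal[of x] x gV(2)[OF xV] by simp
    also have "\<dots> \<le> C * norm (F (of_real x) - F 0)"
      using Lip[of "F (of_real x)"] d'(2)[of "of_real x"] x F0 by simp
    also have "\<dots> \<le> C * (1 / (2 * C) * norm (complex_of_real x))"
      using d(2)[of "of_real x"] x C by (intro mult_left_mono) auto
    also have "\<dots> = x / 2" using C x by simp
    finally show False using x by simp
  qed
  then obtain r1 where r1: "r1 > 0" "ball 0 r1 \<subseteq> ball (0::complex) r" "inj_on F (ball 0 r1)"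
    using has_complex_derivative_locally_injective[OF Fhol _ open_ball] centre_in_ball[of 0 r] r by blast
  define r2 where "r2 = min (min r1 r) e1"
  have r2: "r2 > 0" "r2 \<le> r1" "r2 \<le> r" "r2 \<le> e1" using r1 r e1 by (auto simp: r2_def)
  \<comment> \<open>The bound \<open>r2 / C\<close> forces the real chart coordinate of a curve
    point \<open>F z\<close> below \<open>r2\<close>. Then z and this coordinate both lie in the
    disc where F is injective, so z is real.\<close>
  have "open (ball 0 r \<inter> F -` (ball p (min \<rho> (r2 / C)) \<inter> U))"
    using Fhol UV(1) by (intro continuous_open_preimage holomorphic_on_imp_continuous_on) auto
  moreover have "0 \<in> ball 0 r \<inter> F -` (ball p (min \<rho> (r2 / C)) \<inter> U)"
    using pU C r2 r F0 by auto
  ultimately obtain e0 where "e0 > 0" "ball 0 e0 \<subseteq> ball 0 r \<inter> F -` (ball p (min \<rho> (r2 / C)) \<inter> U)"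
    by (meson open_contains_ball)
  then have e0: "e0 > 0" "\<And>z. norm z < e0 \<Longrightarrow> F z \<in> ball p (min \<rho> (r2 / C)) \<inter> U"
    by (auto simp: subset_iff)
  define e where "e = min e0 r2"
  have e: "e > 0" "e \<le> r2" "e \<le> e0" using e0 r2 by (auto simp: e_def)
  have "F ` (ball 0 e \<inter> \<real>) = \<gamma> \<inter> F ` ball 0 e"
  proof (intro equalityI subsetI)
    fix y assume "y \<in> F ` (ball 0 e \<inter> \<real>)"
    then obtain x where x: "\<bar>x\<bar> < e" "y = F (of_real x)" by (auto elim!: Reals_cases)
    then have "y = g (\<phi> p + of_real x)" using Freal[of x] e r2 by simp
    moreover have "\<phi> p + of_real x \<in> V \<inter> \<real>" using e1(2) x e r2 by (auto simp: dist_norm t)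
    ultimately have "y \<in> \<gamma>" using img g\<phi> by (metis (no_types, lifting) Int_iff imageE)
    then show "y \<in> \<gamma> \<inter> F ` ball 0 e" using x by auto
  next
    fix y assume "y \<in> \<gamma> \<inter> F ` ball 0 e"
    then obtain z where z: "y = F z" "norm z < e" "y \<in> \<gamma>" by auto
    then have y: "y \<in> ball p \<rho>" "norm (y - p) < r2 / C" "y \<in> U"
      using e0(2)[of z] e by (auto simp: dist_norm norm_minus_commute)
    then have "\<phi> y \<in> V \<inter> \<real>" using img z(3) by blast
    then obtain x where "\<phi> y = of_real x" by (auto elim: Reals_cases)
    then have "\<phi> y = \<phi> p + of_real (x - t)" by (simp add: t)
    then obtain x where x: "\<phi> y = \<phi> p + of_real x" by blast
    then have "\<bar>x\<bar> = norm (\<phi> y - \<phi> p)" by simp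
    also have "\<dots> \<le> C * norm (y - p)" using Lip y by blast
    also have "\<dots> < r2" using y(2) C by (simp add: field_simps)
    finally have xr2: "\<bar>x\<bar> < r2" .
    then have "F (of_real x) = y" using Freal[of x] x g\<phi>[OF y(3)] r2 by simp
    moreover have "of_real x \<in> ball (0::complex) r1" "z \<in> ball 0 r1" using xr2 z e r2 by auto
    ultimately have "z = of_real x" using z(1) r1(3) by (metis inj_onD)
    then show "y \<in> F ` (ball 0 e \<inter> \<real>)" using z by auto
  qed
  moreover have "F holomorphic_on ball 0 e" "inj_on F (ball 0 e)"
    using Fhol r1(3) e r2 by (auto intro: holomorphic_on_subset inj_on_subset)
  ultimately show ?thesis unfolding straight_def using e F0 by blast
qed

subsection \<open>Parametrized arcs and germs preserving them\<close>

text \<open>\<open>L\<close> extends the inverse of the parametrization to an ambient open set, so a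
  map g preserving the curve has the real coordinate expression \<open>L (g (c s))\<close>. The
  assumption \<open>image\<close> encodes embeddedness: no other piece of the curve enters
  W.\<close>

locale parametrized_arc =
  fixes \<gamma> :: "complex set" and I :: "real set" and c c' :: "real \<Rightarrow> complex"
    and L :: "complex \<Rightarrow> real" and W :: "complex set"
  assumes I: "open I"
    and der: "\<And>s. s \<in> I \<Longrightarrow> (c has_vector_derivative c' s) (at s)"
    and c'_cont: "continuous_on I c'"
    and W: "open W"
    and L_diff: "\<And>z. z \<in> W \<Longrightarrow> L differentiable (at z)"
    and Lc: "\<And>s. s \<in> I \<Longrightarrow> L (c s) = s"
    and image: "c ` I = \<gamma> \<inter> W"
begin

lemma c_mem: "s \<in> I \<Longrightarrow> c s \<in> \<gamma>" "s \<in> I \<Longrightarrow> c s \<in> W"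
  using image by blast+

lemma cL: "z \<in> \<gamma> \<Longrightarrow> z \<in> W \<Longrightarrow> c (L z) = z" "z \<in> \<gamma> \<Longrightarrow> z \<in> W \<Longrightarrow> L z \<in> I"
  using image Lc by (metis IntI imageE)+

lemma c_cont: "continuous_on I c"
  using der by (meson continuous_at_imp_continuous_on has_vector_derivative_continuous)

lemma c_isCont: "s \<in> I \<Longrightarrow> isCont c s"
  using der by (meson has_vector_derivative_continuous)

lemma L_cont: "continuous_on W L"
  using L_diff by (meson continuous_at_imp_continuous_on differentiable_imp_continuous_within)

lemma c_inj: "inj_on c I"
  using Lc by (metis inj_onI)

text \<open>Differentiating \<open>L (c s) = s\<close> gives 1 on one side and the derivative of L
  applied to \<open>c' s\<close> on the other.\<close>

lemma c'_nonzero: assumes "s \<in> I" shows "c' s \<noteq> 0"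
proof
  assume 0: "c' s = 0"
  obtain L' where L': "(L has_derivative L') (at (c s))"
    using L_diff c_mem(2)[OF assms] unfolding differentiable_def by blast
  have "((\<lambda>t. L (c t)) has_vector_derivative L' (c' s)) (at s)"
    using vector_derivative_diff_chain_within[of c "c' s" s UNIV L L'] der[OF assms] L'
    by (auto simp: o_def intro: has_derivative_at_withinI)
  moreover have "L' 0 = 0" using L' by (metis has_derivative_bounded_linear linear_simps(3))
  ultimately have "((\<lambda>t. L (c t)) has_vector_derivative 0) (at s)" using 0 by simp
  moreover have "((\<lambda>t. L (c t)) has_vector_derivative 1) (at s)"
    by (rule has_vector_derivative_transform_within_open[OF _ I assms])
       (auto simp: Lc has_vector_derivative_id has_vector_derivative_def)
  ultimately show False using vector_derivative_unique_at zero_neq_one by metis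
qed

lemma preimage_open: "open A \<Longrightarrow> open (I \<inter> c -` A)"
  using c_cont I by (rule continuous_open_preimage)

lemma preimage_L_open: "open A \<Longrightarrow> open (W \<inter> L -` A)"
  using L_cont W by (rule continuous_open_preimage)

text \<open>Near s, applying g along the arc is the same as applying \<open>c\<close> to the
  coordinate expression of g. Differentiating both sides shows that g multiplies tangents by a real
  factor.\<close>

lemma transport:
  assumes "s \<in> I" "t \<in> I" "open A" "c s \<in> A" "g holomorphic_on A" "g ` (\<gamma> \<inter> A) \<subseteq> \<gamma>" "g (c s) = c t"
  obtains m where "((\<lambda>s. L (g (c s))) has_real_derivative m) (at s)"
    "deriv g (c s) * c' s = of_real m * c' t"
proof -
  have gder: "(g has_field_derivative deriv g (c s)) (at (c s))"
    using assms by (intro holomorphic_derivI[of g A]) auto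
  have gc: "((\<lambda>s. g (c s)) has_vector_derivative (c' s * deriv g (c s))) (at s)"
    using field_vector_diff_chain_at[OF der[OF assms(1)] gder] by (simp add: o_def)
  obtain L' where L': "(L has_derivative L') (at (c t))"
    using L_diff c_mem(2)[OF assms(2)] unfolding differentiable_def by blast
  define m where "m = L' (c' s * deriv g (c s))"
  have \<theta>: "((\<lambda>s. L (g (c s))) has_vector_derivative m) (at s)"
    using vector_derivative_diff_chain_within[of "\<lambda>s. g (c s)" _ s UNIV L L'] gc L' assms(7)
    by (auto simp: o_def m_def intro: has_derivative_at_withinI)
  then have "((c \<circ> (\<lambda>s. L (g (c s)))) has_vector_derivative (m *\<^sub>R c' t)) (at s)"
    using assms(2,7) by (intro vector_diff_chain_at) (auto simp: Lc intro!: der)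
  moreover have "open (A \<inter> g -` W)"
    using assms W by (intro continuous_open_preimage holomorphic_on_imp_continuous_on) auto
  then have "open (I \<inter> c -` (A \<inter> g -` W))" by (rule preimage_open)
  moreover have "s \<in> I \<inter> c -` (A \<inter> g -` W)" using assms c_mem by auto
  moreover have "(c \<circ> (\<lambda>s. L (g (c s)))) s' = g (c s')" if "s' \<in> I \<inter> c -` (A \<inter> g -` W)" for s'
    using that assms(6) c_mem by (auto intro!: cL)
  ultimately have "((\<lambda>s. g (c s)) has_vector_derivative (m *\<^sub>R c' t)) (at s)"
    by (rule has_vector_derivative_transform_within_open)
  then have "c' s * deriv g (c s) = m *\<^sub>R c' t" using gc vector_derivative_unique_at by blast
  then show ?thesis
    using that \<theta> by (simp add: has_real_derivative_iff_has_vector_derivative scaleR_conv_of_real mult.commute)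
qed

text \<open>The multiplier compares the velocities of the parametrization at both ends, so it is
  real and multiplicative under composition. Only an inclusion into the curve is demanded; that g
  fills the curve near \<open>c t\<close> follows from \<open>m \<noteq> 0\<close>.\<close>

definition germ :: "real \<Rightarrow> real \<Rightarrow> real \<Rightarrow> (complex \<Rightarrow> complex) \<Rightarrow> bool" where
  "germ s t m g \<longleftrightarrow> s \<in> I \<and> t \<in> I \<and> m \<noteq> 0 \<and> g (c s) = c t \<and> deriv g (c s) * c' s = of_real m * c' t \<and>
     (\<exists>A. open A \<and> c s \<in> A \<and> g holomorphic_on A \<and> g ` (\<gamma> \<inter> A) \<subseteq> \<gamma>)"

lemma germ_exists:
  assumes "s \<in> I" "t \<in> I" "open A" "c s \<in> A" "g holomorphic_on A" "g ` (\<gamma> \<inter> A) \<subseteq> \<gamma>" "g (c s) = c t"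
    and "deriv g (c s) \<noteq> 0"
  obtains m where "germ s t m g" "((\<lambda>s. L (g (c s))) has_real_derivative m) (at s)"
proof -
  obtain m where m: "((\<lambda>s. L (g (c s))) has_real_derivative m) (at s)"
    "deriv g (c s) * c' s = of_real m * c' t"
    using transport[OF assms(1-7)] by metis
  then have "m \<noteq> 0" using c'_nonzero[OF assms(1)] assms(8) by auto
  then show ?thesis using that[of m] m assms unfolding germ_def by blast
qed

lemma germ_compose:
  assumes "germ s t m g" "germ t u n h"
  shows "germ s u (n * m) (h \<circ> g)"
proof -
  obtain A B where A: "open A" "c s \<in> A" "g holomorphic_on A" "g ` (\<gamma> \<inter> A) \<subseteq> \<gamma>"
    and B: "open B" "c t \<in> B" "h holomorphic_on B" "h ` (\<gamma> \<inter> B) \<subseteq> \<gamma>"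
    using assms unfolding germ_def by blast
  have st: "s \<in> I" "u \<in> I" "m \<noteq> 0" "n \<noteq> 0" "g (c s) = c t" "h (c t) = c u"
    "deriv g (c s) * c' s = of_real m * c' t" "deriv h (c t) * c' t = of_real n * c' u"
    using assms unfolding germ_def by auto
  have "open (A \<inter> g -` B)"
    using A B by (intro continuous_open_preimage holomorphic_on_imp_continuous_on) auto
  moreover have "c s \<in> A \<inter> g -` B" using A B st by auto
  moreover have "(h \<circ> g) holomorphic_on (A \<inter> g -` B)"
    by (rule holomorphic_on_compose_gen[of _ _ _ B]) (use A B in \<open>auto intro: holomorphic_on_subset\<close>)
  moreover have "(h \<circ> g) ` (\<gamma> \<inter> (A \<inter> g -` B)) \<subseteq> \<gamma>" using A B by force
  moreover have "deriv (h \<circ> g) (c s) = deriv h (c t) * deriv g (c s)"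
    using A B st by (subst deriv_chain) (auto intro!: holomorphic_on_imp_differentiable_at)
  then have "deriv (h \<circ> g) (c s) * c' s = of_real (n * m) * c' u"
    using st by (simp add: mult.assoc)
  ultimately show ?thesis unfolding germ_def using st by auto
qed

text \<open>The inclusion for g says nothing directly about its inverse. In the parameter, however,
  g is continuous and injective, so by invariance of domain its image is open, and the inverse
  preserves the part of the curve with parameters in that image.\<close>

lemma germ_inverse:
  assumes "germ s t m g"
  obtains h where "germ t s (1 / m) h"
proof -
  obtain A where A: "open A" "c s \<in> A" "g holomorphic_on A" "g ` (\<gamma> \<inter> A) \<subseteq> \<gamma>"
    using assms unfolding germ_def by blast
  have st: "s \<in> I" "t \<in> I" "m \<noteq> 0" "g (c s) = c t" "deriv g (c s) * c' s = of_real m * c' t"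
    using assms unfolding germ_def by auto
  have "open (A \<inter> g -` W)"
    using A W by (intro continuous_open_preimage holomorphic_on_imp_continuous_on) auto
  moreover have "c s \<in> A \<inter> g -` W" using A st c_mem by auto
  moreover have "g holomorphic_on (A \<inter> g -` W)" using A by (auto intro: holomorphic_on_subset)
  moreover have "deriv g (c s) \<noteq> 0" using st c'_nonzero by auto
  ultimately obtain r where r: "r > 0" "ball (c s) r \<subseteq> A \<inter> g -` W" "inj_on g (ball (c s) r)"
    using has_complex_derivative_locally_injective by blast
  define B where "B = ball (c s) r"
  have B: "open B" "c s \<in> B" "B \<subseteq> A" "g ` B \<subseteq> W" "inj_on g B" "g holomorphic_on B"
    using r A by (auto simp: B_def intro: holomorphic_on_subset)
  obtain h where h: "h holomorphic_on g ` B" "\<And>z. z \<in> B \<Longrightarrow> deriv g z * deriv h (g z) = 1"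
    "\<And>z. z \<in> B \<Longrightarrow> h (g z) = z"
    using holomorphic_has_inverse[OF B(6,1,5)] by metis
  define N where "N = I \<inter> c -` B"
  have N: "open N" "s \<in> N" unfolding N_def using B st by (auto intro: preimage_open)
  define \<theta> where "\<theta> s = L (g (c s))" for s
  have \<theta>: "c (\<theta> u) = g (c u)" if "u \<in> N" for u
  proof -
    have "c u \<in> \<gamma> \<inter> A" "c u \<in> B" using that B c_mem by (auto simp: N_def)
    then show ?thesis unfolding \<theta>_def using A(4) B(4) by (intro cL) blast+
  qed
  have "continuous_on N \<theta>" unfolding \<theta>_def
    by (rule continuous_on_compose2[OF L_cont continuous_on_compose2[OF
          holomorphic_on_imp_continuous_on[OF B(6)] continuous_on_subset[OF c_cont]]])
       (use B in \<open>auto simp: N_def\<close>)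
  moreover have "inj_on \<theta> N"
  proof (rule inj_onI)
    fix u v assume uv: "u \<in> N" "v \<in> N" "\<theta> u = \<theta> v"
    then have "g (c u) = g (c v)" using \<theta> by metis
    then have "c u = c v" using uv B(5) by (auto simp: N_def dest: inj_onD)
    then show "u = v" using c_inj uv by (auto simp: N_def dest: inj_onD)
  qed
  ultimately have "open (\<theta> ` N)" using N by (intro invariance_of_domain)
  then have "open (g ` B \<inter> (W \<inter> L -` (\<theta> ` N)))"
    using B by (intro open_Int preimage_L_open open_mapping_thm3)
  moreover have "c t \<in> g ` B \<inter> (W \<inter> L -` (\<theta> ` N))"
    using st B N c_mem by (force simp: \<theta>_def)
  moreover have "h holomorphic_on g ` B \<inter> (W \<inter> L -` (\<theta> ` N))"
    using h by (auto intro: holomorphic_on_subset)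
  moreover have "h ` (\<gamma> \<inter> (g ` B \<inter> (W \<inter> L -` (\<theta> ` N)))) \<subseteq> \<gamma>"
  proof clarify
    fix w u assume w: "g w \<in> \<gamma>" "g w \<in> W" "L (g w) = \<theta> u" "u \<in> N" 
    then have "g w = g (c u)" using cL(1) \<theta> by metis
    then have "h (g w) = c u" using h(3) w by (auto simp: N_def)
    then show "h (g w) \<in> \<gamma>" using w c_mem by (auto simp: N_def)
  qed
  moreover have "h (c t) = c s" using h(3)[of "c s"] B st by simp
  moreover have "deriv h (c t) * c' t = of_real (1 / m) * c' s"
  proof -
    have "deriv g (c s) * deriv h (c t) = 1" using h(2)[of "c s"] B st by simp
    then have "of_real m * c' t * deriv h (c t) = c' s" using st by (metis mult.assoc mult.commute mult_1)
    then show ?thesis using st(3) by (simp add: field_simps)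
  qed
  moreover have "1 / m \<noteq> 0" using st(3) by simp
  ultimately have "germ t s (1 / m) h" using st(1,2) unfolding germ_def by blast
  then show ?thesis by (rule that)
qed

text \<open>A primitive of \<open>\<Psi>\<close> maps the curve into the real axis.\<close>

lemma straight_if_real_along_arc:
  assumes "s \<in> I" "open A" "c s \<in> A" "\<Psi> holomorphic_on A" "\<Psi> (c s) \<noteq> 0"
    and real: "\<And>u. u \<in> I \<Longrightarrow> c u \<in> A \<Longrightarrow> \<Psi> (c u) * c' u \<in> \<real>"
  shows "straight \<gamma> (c s)"
proof -
  have "open (A \<inter> W)" "c s \<in> A \<inter> W" using assms(1-3) W c_mem by auto
  then obtain r where r: "r > 0" "ball (c s) r \<subseteq> A \<inter> W" by (meson open_contains_ball)
  have \<Psi>hol: "\<Psi> holomorphic_on ball (c s) r" using assms(4) r by (auto intro: holomorphic_on_subset)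
  obtain F where F0: "\<And>x. x \<in> ball (c s) r \<Longrightarrow> (F has_field_derivative \<Psi> x) (at x within ball (c s) r)"
    using holomorphic_convex_primitive'[OF convex_ball open_ball \<Psi>hol] by blast
  have F: "(F has_field_derivative \<Psi> x) (at x)" if "x \<in> ball (c s) r" for x
    using F0[OF that] at_within_open[OF that open_ball] by simp
  define G where "G z = F z - F (c s)" for z
  have G: "(G has_field_derivative \<Psi> x) (at x)" if "x \<in> ball (c s) r" for x
    unfolding G_def by (auto intro!: derivative_eq_intros F that)
  have "G holomorphic_on ball (c s) r" using G by (subst holomorphic_on_open) blast+
  moreover have "deriv G (c s) \<noteq> 0" using G[of "c s"] r assms(5) by (simp add: DERIV_imp_deriv)
  ultimately obtain r1 where r1: "r1 > 0" "ball (c s) r1 \<subseteq> ball (c s) r" "inj_on G (ball (c s) r1)"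
    using has_complex_derivative_locally_injective[of G "ball (c s) r" "c s"] r(1) centre_in_ball open_ball
    by blast
  define B where "B = ball (c s) r1"
  have B: "open B" "c s \<in> B" "B \<subseteq> ball (c s) r" "inj_on G B" "G holomorphic_on B" "B \<subseteq> A"
    using r1 r \<open>G holomorphic_on ball (c s) r\<close> by (auto simp: B_def intro: holomorphic_on_subset)
  obtain h where h: "h holomorphic_on G ` B" "\<And>z. z \<in> B \<Longrightarrow> h (G z) = z"
    using holomorphic_has_inverse[OF B(5,1,4)] by metis
  have "open (I \<inter> c -` B)" "s \<in> I \<inter> c -` B" using B assms(1) by (auto intro: preimage_open)
  then obtain \<eta> where \<eta>: "\<eta> > 0" "ball s \<eta> \<subseteq> I \<inter> c -` B" by (meson open_contains_ball)
  define N where "N = ball s \<eta>"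
  have N: "open N" "connected N" "s \<in> N" "N \<subseteq> I" "c ` N \<subseteq> B" using \<eta> by (auto simp: N_def)
  have Gc: "((\<lambda>u. G (c u)) has_vector_derivative (\<Psi> (c u) * c' u)) (at u)" if "u \<in> N" for u
  proof -
    have "c u \<in> ball (c s) r" "u \<in> I" using that N(4,5) B(3) by blast+
    then show ?thesis
      using field_vector_diff_chain_at[OF der G] by (simp add: o_def mult.commute)
  qed
  have Im0: "Im (G (c u)) = 0" if "u \<in> N" for u
  proof -
    have D: "((\<lambda>u. Im (G (c u))) has_real_derivative 0) (at v)" if "v \<in> N" for v
    proof -
      have "\<Psi> (c v) * c' v \<in> \<real>" using that N B by (intro real) auto
      then have "Im (\<Psi> (c v) * c' v) = 0" by (simp only: complex_is_Real_iff)
      then show ?thesis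
        using bounded_linear.has_vector_derivative[OF bounded_linear_Im Gc[OF that]]
        by (simp only: has_real_derivative_iff_has_vector_derivative)
    qed
    have "Im (G (c u)) = Im (G (c s))"
      by (rule DERIV_zero_connected_constant[OF N(2,1) finite.emptyI]) 
         (use D that N in \<open>auto intro!: continuous_at_imp_continuous_on DERIV_isCont\<close>)
    then show ?thesis by (simp add: G_def)
  qed
  have Gcu: "G (c u) = of_real (Re (G (c u)))" if "u \<in> N" for u
    using Im0[OF that] by (simp add: complex_eq_iff)
  have "continuous_on N (\<lambda>u. Re (G (c u)))"
    by (intro continuous_on_Re continuous_at_imp_continuous_on ballI
          has_vector_derivative_continuous[OF Gc])
  moreover have "inj_on (\<lambda>u. Re (G (c u))) N"
  proof (rule inj_onI)
    fix u v assume uv: "u \<in> N" "v \<in> N" "Re (G (c u)) = Re (G (c v))"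
    then have "G (c u) = G (c v)" using Gcu by metis
    then have "c u = c v" using uv B(4) N(5) by (auto dest: inj_onD)
    then show "u = v" using c_inj uv N(4) by (auto dest: inj_onD)
  qed
  \<comment> \<open>The real values of G along the arc fill an interval around 0, so every small
    real number comes from a point of the curve.\<close>
  ultimately have "open ((\<lambda>u. Re (G (c u))) ` N)" using N by (intro invariance_of_domain)
  moreover have "0 \<in> (\<lambda>u. Re (G (c u))) ` N" using N by (auto simp: G_def image_iff intro!: bexI[of _ s])
  ultimately obtain e1 where e1: "e1 > 0" "ball 0 e1 \<subseteq> (\<lambda>u. Re (G (c u))) ` N"
    by (meson open_contains_ball)
  have "open (G ` B)" using B by (intro open_mapping_thm3)
  \<comment> \<open>The second radius confines the image of the disc to points of W with parameter
    in N. A curve point there is some \<open>c u\<close> with u in N, where G is real.\<close>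
  then have "open (G ` B \<inter> h -` (W \<inter> L -` N))"
    using h(1) N by (intro continuous_open_preimage holomorphic_on_imp_continuous_on preimage_L_open)
  moreover have "0 \<in> G ` B \<inter> h -` (W \<inter> L -` N)"
  proof -
    have "G (c s) = 0" by (simp add: G_def)
    then have "0 \<in> G ` B" "h 0 = c s" using B h(2)[of "c s"] by (auto simp: image_iff intro!: bexI[of _ "c s"])
    then show ?thesis using assms(1) c_mem Lc N by auto
  qed
  ultimately obtain e2 where e2: "e2 > 0" "ball 0 e2 \<subseteq> G ` B \<inter> h -` (W \<inter> L -` N)"
    by (meson open_contains_ball)
  define e where "e = min e1 e2"
  have e: "e > 0" "ball 0 e \<subseteq> (\<lambda>u. Re (G (c u))) ` N" "ball 0 e \<subseteq> G ` B" "h ` ball 0 e \<subseteq> W \<inter> L -` N"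
    using e1 e2 by (auto simp: e_def)
  have Gh: "G (h z) = z" if "z \<in> ball 0 e" for z using that e(3) h(2) by force
  have "h ` (ball 0 e \<inter> \<real>) = \<gamma> \<inter> h ` ball 0 e"
  proof (intro equalityI subsetI)
    fix y assume "y \<in> h ` (ball 0 e \<inter> \<real>)"
    then obtain x where x: "\<bar>x\<bar> < e" "y = h (of_real x)" by (auto elim!: Reals_cases)
    then obtain u where u: "u \<in> N" "x = Re (G (c u))" using e(2) by (auto simp: subset_iff)
    then have "y = c u" using x Gcu[OF u(1)] h(2) N(5) by auto
    then have "y \<in> \<gamma>" using u N(4) c_mem(1) by blast
    moreover have "y \<in> h ` ball 0 e" unfolding x(2) using x(1) by (intro imageI) simp
    ultimately show "y \<in> \<gamma> \<inter> h ` ball 0 e" by blast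
  next
    fix y assume "y \<in> \<gamma> \<inter> h ` ball 0 e"
    then obtain z where z: "z \<in> ball 0 e" "y = h z" "y \<in> \<gamma>" by auto
    then have "y \<in> W \<inter> L -` N" using e(4) by blast
    then have "L y \<in> N" "c (L y) = y" using z cL by auto
    then have "z = of_real (Re (G (c (L y))))" using Gcu[of "L y"] Gh[OF z(1)] z by simp
    then show "y \<in> h ` (ball 0 e \<inter> \<real>)" using z by (metis IntI Reals_of_real imageI)
  qed
  moreover have "h holomorphic_on ball 0 e" using h e by (auto intro: holomorphic_on_subset)
  moreover have "inj_on h (ball 0 e)" using Gh by (metis inj_onI)
  moreover have "h 0 = c s" using h(2)[of "c s"] B by (simp add: G_def)
  ultimately show ?thesis unfolding straight_def using e(1) by blast
qed

end

subsection \<open>Isotropy germs\<close>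

lemma prod_le_exp_sum:
  fixes f :: "'a \<Rightarrow> real"
  assumes "\<And>i. i \<in> A \<Longrightarrow> 0 \<le> f i" "\<And>i. i \<in> A \<Longrightarrow> f i \<le> 1 + g i"
  shows "prod f A \<le> exp (sum g A)"
proof (cases "finite A")
  case True
  have "prod f A \<le> (\<Prod>i\<in>A. exp (g i))"
    using assms by (intro prod_mono) (meson exp_ge_add_one_self order_trans)
  then show ?thesis by (simp add: exp_sum True)
qed simp

lemma geometric_sum_le:
  fixes x :: real
  assumes "0 \<le> x" "x < 1"
  shows "(\<Sum>i<n. x ^ i) \<le> 1 / (1 - x)"
  using assms by (simp add: sum_gp_strict divide_right_mono)

lemma has_field_derivative_approx:
  fixes f :: "'a::real_normed_field \<Rightarrow> 'a"
  assumes "(f has_field_derivative D) (at p)" "e > 0"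
  obtains d where "d > 0"
    "\<And>z. norm (z - p) < d \<Longrightarrow> norm (f z - f p - D * (z - p)) \<le> e * norm (z - p)"
  using assms unfolding has_field_derivative_def has_derivative_at_alt by blast

context parametrized_arc
begin

text \<open>By the chain rule \<open>P n\<close> is the derivative of the n-th iterate divided by
  \<open>m ^ n\<close>, written as a product along the orbit. Orbits approach p geometrically and q
  = 1 at p, so the products are uniformly bounded and a subsequence converges. The limit is the
  derivative of the Koenigs linearizing coordinate.\<close>

lemma contraction_imp_straight:
  assumes "germ s s m g" "\<bar>m\<bar> < 1"
  shows "straight \<gamma> (c s)"
proof -
  define p where "p = c s"
  obtain A where A: "open A" "p \<in> A" "g holomorphic_on A" "g ` (\<gamma> \<inter> A) \<subseteq> \<gamma>"
    using assms unfolding germ_def p_def by blast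
  have st: "s \<in> I" "m \<noteq> 0" "g p = p" "deriv g p * c' s = of_real m * c' s"
    using assms unfolding germ_def p_def by auto
  have gm: "deriv g p = of_real m" using st c'_nonzero by auto
  define q where "q z = deriv g z / of_real m" for z
  have qhol: "q holomorphic_on A" unfolding q_def using A st by (intro holomorphic_intros holomorphic_deriv) auto
  have qp: "q p = 1" using gm st by (simp add: q_def)
  \<comment> \<open>The midpoint of |m| and 1; the gap (1 - |m|) / 2 absorbs the error of the linear
    approximation at p.\<close>
  define \<mu> where "\<mu> = (\<bar>m\<bar> + 1) / 2"
  have \<mu>: "0 < \<mu>" "\<mu> < 1" "\<mu> = \<bar>m\<bar> + (1 - \<bar>m\<bar>) / 2" using assms(2) by (auto simp: \<mu>_def field_simps)
  have "(g has_field_derivative of_real m) (at p)"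
    using A gm by (metis holomorphic_derivI)
  then obtain d1 where d1: "d1 > 0"
    "\<And>z. norm (z - p) < d1 \<Longrightarrow> norm (g z - g p - of_real m * (z - p)) \<le> (1 - \<bar>m\<bar>) / 2 * norm (z - p)"
    using has_field_derivative_approx[of g "of_real m" p "(1 - \<bar>m\<bar>) / 2"] assms(2) by auto
  have "(q has_field_derivative deriv q p) (at p)" using A qhol by (metis holomorphic_derivI)
  then obtain d2 where d2: "d2 > 0"
    "\<And>z. norm (z - p) < d2 \<Longrightarrow> norm (q z - q p - deriv q p * (z - p)) \<le> 1 * norm (z - p)"
    using has_field_derivative_approx[of q "deriv q p" p 1] zero_less_one by blast
  have "open (A \<inter> W)" "p \<in> A \<inter> W" using A W c_mem st by (auto simp: p_def)
  then obtain d3 where d3: "d3 > 0" "ball p d3 \<subseteq> A \<inter> W" by (meson open_contains_ball)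
  define r where "r = Min {d1, d2, d3}"
  have r: "r > 0" "r \<le> d1" "r \<le> d2" "r \<le> d3" using d1 d2 d3 by (auto simp: r_def)
  define B where "B = ball p r"
  have B: "open B" "p \<in> B" "B \<subseteq> A" "B \<subseteq> W" using r d3 by (auto simp: B_def)
  have contr: "norm (g z - p) \<le> \<mu> * norm (z - p)" if "z \<in> B" for z
  proof -
    have "norm (g z - p) \<le> norm (g z - g p - of_real m * (z - p)) + norm (of_real m * (z - p))"
      using norm_triangle_ineq[of "g z - g p - of_real m * (z - p)" "of_real m * (z - p)"] st by simp
    also have "\<dots> \<le> (1 - \<bar>m\<bar>) / 2 * norm (z - p) + \<bar>m\<bar> * norm (z - p)"
      using that r by (intro add_mono d1) (auto simp: B_def dist_norm norm_minus_commute norm_mult)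
    also have "\<dots> = \<mu> * norm (z - p)" unfolding \<mu>(3) by (simp only: distrib_right add.commute)
    finally show ?thesis .
  qed
  define K where "K = norm (deriv q p) + 1"
  have qbound: "norm (q z) \<le> 1 + K * norm (z - p)" if "z \<in> B" for z
  proof -
    have "norm (q z) \<le> norm (q z - q p - deriv q p * (z - p)) + norm (deriv q p * (z - p)) + norm (q p)"
      using norm_triangle_ineq[of "q z - q p - deriv q p * (z - p)" "deriv q p * (z - p)"]
        norm_triangle_ineq[of "q z - q p" "q p"] by simp
    also have "\<dots> \<le> 1 * norm (z - p) + norm (deriv q p) * norm (z - p) + 1"
      using that r qp by (intro add_mono d2) (auto simp: B_def dist_norm norm_minus_commute norm_mult)
    finally show ?thesis by (simp add: K_def algebra_simps)
  qed
  have iter: "(g ^^ n) z \<in> B \<and> norm ((g ^^ n) z - p) \<le> \<mu> ^ n * norm (z - p)" if "z \<in> B" for n z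
  proof (induction n)
    case 0
    then show ?case using that by simp
  next
    case (Suc n)
    have "norm (g ((g ^^ n) z) - p) \<le> \<mu> * norm ((g ^^ n) z - p)" using Suc contr by blast
    moreover have "\<dots> \<le> \<mu> * (\<mu> ^ n * norm (z - p))" using Suc \<mu> by (intro mult_left_mono) auto
    moreover have "\<mu> * norm ((g ^^ n) z - p) \<le> 1 * norm ((g ^^ n) z - p)"
      using \<mu> by (intro mult_right_mono) auto
    ultimately show ?case using Suc by (auto simp: B_def dist_norm norm_minus_commute mult.assoc)
  qed
  have iter_hol: "(g ^^ n) holomorphic_on B" for n
  proof (induction n)
    case 0
    show ?case by (simp add: id_def holomorphic_on_ident)
  next
    case (Suc n)
    have "g \<circ> (g ^^ n) holomorphic_on B"
      using Suc A(3) B(3) iter by (intro holomorphic_on_compose_gen[of _ _ _ A]) auto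
    then show ?case by (simp add: o_def)
  qed
  have iter_p: "(g ^^ n) p = p" for n by (induction n) (auto simp: st)
  define P where "P n z = (\<Prod>i<n. q ((g ^^ i) z))" for n z
  have P_hol: "P n holomorphic_on B" for n unfolding P_def
  proof (intro holomorphic_on_prod)
    fix i
    have "q \<circ> (g ^^ i) holomorphic_on B"
      using iter_hol qhol B(3) iter by (intro holomorphic_on_compose_gen[of _ _ _ A]) auto
    then show "(\<lambda>z. q ((g ^^ i) z)) holomorphic_on B" by (simp add: o_def)
  qed
  have P_bound: "norm (P n z) \<le> exp (K * r / (1 - \<mu>))" if "z \<in> B" for n z
  proof -
    have K: "K \<ge> 0" by (simp add: K_def)
    have zr: "norm (z - p) \<le> r" using that by (auto simp: B_def dist_norm norm_minus_commute)
    have "norm (P n z) = (\<Prod>i<n. norm (q ((g ^^ i) z)))" by (simp add: P_def prod_norm)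
    also have "\<dots> \<le> exp (\<Sum>i<n. K * r * \<mu> ^ i)"
    proof (rule prod_le_exp_sum)
      fix i
      have "norm (q ((g ^^ i) z)) \<le> 1 + K * norm ((g ^^ i) z - p)" using qbound iter that by blast
      also have "K * norm ((g ^^ i) z - p) \<le> K * (\<mu> ^ i * r)"
        using iter[OF that, of i] zr K \<mu> by (intro mult_left_mono) (auto intro: order_trans mult_left_mono)
      finally show "norm (q ((g ^^ i) z)) \<le> 1 + K * r * \<mu> ^ i" by (simp add: algebra_simps)
    qed auto
    also have "\<dots> \<le> exp (K * r / (1 - \<mu>))"
      using mult_left_mono[OF geometric_sum_le[of \<mu> n], of "K * r"] \<mu> K r(1) by (simp add: sum_distrib_left)
    finally show ?thesis .
  qed
  obtain \<Psi> k where \<Psi>: "\<Psi> holomorphic_on B" and k: "strict_mono (k :: nat \<Rightarrow> nat)"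
    and lim: "\<And>z. z \<in> B \<Longrightarrow> (\<lambda>n. P (k n) z) \<longlonglongrightarrow> \<Psi> z"
    using Montel[of B "range P" P] B(1) P_hol P_bound by (smt (verit, best) imageE order_refl subsetD)
  have "P n p = 1" for n by (simp add: P_def iter_p qp)
  then have \<Psi>p: "\<Psi> p = 1" using lim[OF B(2)] LIMSEQ_unique[OF _ tendsto_const] by auto
  have real: "\<Psi> (c u) / c' s * c' u \<in> \<real>" if u: "u \<in> I" "c u \<in> B" for u
  proof -
    define \<sigma> where "\<sigma> n = L ((g ^^ n) (c u))" for n
    \<comment> \<open>The tracked quotient is the derivative of the coordinate expression of the
      n-th iterate, divided by \<open>m ^ n\<close>, hence real. Its denominator tends to
      \<open>c' s\<close>, which is why \<Psi> is divided by this constant.\<close>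
    have main: "\<sigma> n \<in> I \<and> c (\<sigma> n) = (g ^^ n) (c u) \<and> (g ^^ n) (c u) \<in> \<gamma> \<and> P n (c u) * c' u / c' (\<sigma> n) \<in> \<real>" for n
    proof (induction n)
      case 0
      show ?case using u c_mem Lc c'_nonzero by (auto simp: \<sigma>_def P_def)
    next
      case (Suc n)
      have 1: "(g ^^ n) (c u) \<in> B" "(g ^^ Suc n) (c u) \<in> B" using iter u by blast+
      have 2: "(g ^^ Suc n) (c u) \<in> \<gamma>" using Suc 1 A(4) B(3) by auto
      have 3: "\<sigma> (Suc n) \<in> I" "c (\<sigma> (Suc n)) = (g ^^ Suc n) (c u)"
        unfolding \<sigma>_def using cL[OF 2] 1 B(4) by auto
      obtain m' where m': "deriv g (c (\<sigma> n)) * c' (\<sigma> n) = of_real m' * c' (\<sigma> (Suc n))"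
      proof (rule transport[of "\<sigma> n" "\<sigma> (Suc n)" A g])
        show "c (\<sigma> n) \<in> A" "g (c (\<sigma> n)) = c (\<sigma> (Suc n))" using Suc 1 3 B(3) by auto
      qed (use Suc A 3 in auto)
      have "P (Suc n) (c u) * c' u / c' (\<sigma> (Suc n)) =
          (P n (c u) * c' u / c' (\<sigma> n)) * of_real (m' / m)"
      proof -
        have "deriv g (c (\<sigma> n)) = of_real m' * c' (\<sigma> (Suc n)) / c' (\<sigma> n)"
          using m' c'_nonzero[of "\<sigma> n"] Suc by (simp add: field_simps)
        then show ?thesis
          using c'_nonzero[OF 3(1)] Suc by (simp add: P_def q_def)
      qed
      then show ?case using Suc 2 3 by (simp only: Reals_mult Reals_of_real simp_thms)
    qed
    have "(\<lambda>n. (g ^^ n) (c u)) \<longlonglongrightarrow> p"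
    proof (rule LIM_zero_cancel, rule Lim_null_comparison)
      show "\<forall>\<^sub>F n in sequentially. norm ((g ^^ n) (c u) - p) \<le> \<mu> ^ n * norm (c u - p)"
        using iter u by auto
      show "(\<lambda>n. \<mu> ^ n * norm (c u - p)) \<longlonglongrightarrow> 0"
        using \<mu> by (intro tendsto_mult_left_zero LIMSEQ_realpow_zero) auto
    qed
    moreover have "isCont L p" using L_cont W B by (meson continuous_on_eq_continuous_at subsetD)
    ultimately have "\<sigma> \<longlonglongrightarrow> L p" unfolding \<sigma>_def using isCont_tendsto_compose by blast
    then have "\<sigma> \<longlonglongrightarrow> s" using Lc st by (simp add: p_def)
    moreover have "isCont c' s" using c'_cont I st(1) by (meson continuous_on_eq_continuous_at)
    ultimately have "(\<lambda>n. c' (\<sigma> n)) \<longlonglongrightarrow> c' s" by (rule isCont_tendsto_compose[rotated])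
    then have "(\<lambda>n. c' (\<sigma> (k n))) \<longlonglongrightarrow> c' s" using k by (rule LIMSEQ_subseq_LIMSEQ[unfolded o_def])
    then have lim': "(\<lambda>n. P (k n) (c u) * c' u / c' (\<sigma> (k n))) \<longlonglongrightarrow> \<Psi> (c u) * c' u / c' s"
      using c'_nonzero[OF st(1)] by (intro tendsto_intros lim u)
    have "\<Psi> (c u) * c' u / c' s \<in> \<real>"
      by (rule closed_sequentially[OF closed_complex_Reals _ lim']) (use main in blast)
    then show ?thesis by simp
  qed
  have "(\<lambda>z. \<Psi> z / c' s) holomorphic_on B"
    using \<Psi> c'_nonzero[OF st(1)] by (intro holomorphic_intros) auto
  then show ?thesis
    using straight_if_real_along_arc[of s B "\<lambda>z. \<Psi> z / c' s"] real B st \<Psi>p c'_nonzero[OF st(1)]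
    by (simp add: p_def)
qed

lemma isotropy_multiplier:
  assumes "germ s s m g" "\<not> straight \<gamma> (c s)"
  shows "\<bar>m\<bar> = 1"
proof (rule ccontr)
  assume "\<bar>m\<bar> \<noteq> 1"
  then consider "\<bar>m\<bar> < 1" | "\<bar>m\<bar> > 1" by linarith
  then show False
  proof cases
    case 1
    then show False using contraction_imp_straight assms by blast
  next
    case 2
    obtain h where "germ s s (1 / m) h" using germ_inverse[OF assms(1)] .
    moreover have "\<bar>1 / m\<bar> < 1" using 2 by (simp add: field_simps)
    ultimately show False using contraction_imp_straight assms(2) by blast
  qed
qed

end

subsection \<open>Local flows\<close>

text \<open>On each cell F differs from its linearization with left-end slope by at most the cell
  length times the oscillation of f, and the increments of F telescope. This identifies the limit of
  the finite averages of the flow on the curve.\<close>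

lemma equidistant_sums_tendsto:
  fixes f :: "real \<Rightarrow> 'a::real_normed_vector"
  assumes "a < b" and cont: "continuous_on {a..b} f"
    and F: "\<And>x. x \<in> {a..b} \<Longrightarrow> (F has_vector_derivative f x) (at x within {a..b})"
  shows "(\<lambda>n. \<Sum>k<n. ((b - a) / real n) *\<^sub>R f (a + real k * ((b - a) / real n))) \<longlonglongrightarrow> F b - F a"
proof (rule LIMSEQ_I)
  fix \<epsilon> :: real assume "\<epsilon> > 0"
  define \<epsilon>' where "\<epsilon>' = \<epsilon> / (2 * (b - a))"
  have \<epsilon>': "\<epsilon>' > 0" using \<open>\<epsilon> > 0\<close> assms(1) by (simp add: \<epsilon>'_def)
  have "uniformly_continuous_on {a..b} f" using cont by (intro compact_uniformly_continuous) auto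
  then obtain \<delta> where \<delta>: "\<delta> > 0" "\<And>x y. x \<in> {a..b} \<Longrightarrow> y \<in> {a..b} \<Longrightarrow> dist y x < \<delta> \<Longrightarrow> dist (f y) (f x) < \<epsilon>'"
    using \<epsilon>' unfolding uniformly_continuous_on_def by metis
  obtain N :: nat where N: "(b - a) / \<delta> < real N" using reals_Archimedean2 by blast
  have "norm ((\<Sum>k<n. ((b - a) / real n) *\<^sub>R f (a + real k * ((b - a) / real n))) - (F b - F a)) < \<epsilon>" if n: "n \<ge> N" for n
  proof -
    define h where "h = (b - a) / real n"
    define x where "x k = a + real k * h" for k
    have "(b - a) / \<delta> < real n" using N n by linarith
    then have n0: "n > 0" using \<delta> assms(1) by (cases n) (auto simp: field_simps)
    have h: "h > 0" "h < \<delta>" "real n * h = b - a"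
      using n0 \<open>(b - a) / \<delta> < real n\<close> \<delta> assms(1) by (auto simp: h_def field_simps)
    have x: "x k \<in> {a..b}" "x (Suc k) \<in> {a..b}" "x (Suc k) - x k = h" if "k < n" for k
    proof -
      have "real (Suc k) * h \<le> real n * h" using that h by (intro mult_right_mono) auto
      then show "x k \<in> {a..b}" "x (Suc k) \<in> {a..b}" "x (Suc k) - x k = h"
        using h by (auto simp: x_def algebra_simps)
    qed
    have step: "norm (F (x (Suc k)) - F (x k) - h *\<^sub>R f (x k)) \<le> h * \<epsilon>'" if k: "k < n" for k
    proof -
      have "{x k..x (Suc k)} \<subseteq> {a..b}" using x[OF k] by auto
      then have "(F has_vector_derivative f y) (at y within {x k..x (Suc k)})" if "y \<in> {x k..x (Suc k)}" for y
        using that F by (meson has_vector_derivative_within_subset subsetD)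
      moreover have "norm (f y - f (x k)) \<le> \<epsilon>'" if "y \<in> {x k..x (Suc k)}" for y
        using \<delta>(2)[of "x k" y] that x[OF k] h by (auto simp: dist_norm intro: less_imp_le)
      ultimately have "norm (F (x (Suc k)) - F (x k) - (x (Suc k) - x k) *\<^sub>R f (x k)) \<le> norm (x (Suc k) - x k) * \<epsilon>'"
        using x(3)[OF k] h
        by (intro vector_differentiable_bound_linearization[of "{x k..x (Suc k)}" F f])
           (auto simp: closed_segment_eq_real_ivl)
      then show ?thesis using x(3)[OF k] h by simp
    qed
    have "F b - F a = (\<Sum>k<n. F (x (Suc k)) - F (x k))"
      using h by (subst sum_lessThan_telescope) (simp add: x_def)
    then have "norm ((\<Sum>k<n. h *\<^sub>R f (x k)) - (F b - F a)) = norm (\<Sum>k<n. F (x (Suc k)) - F (x k) - h *\<^sub>R f (x k))"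
      by (simp add: sum_subtractf norm_minus_commute)
    also have "\<dots> \<le> (\<Sum>k<n. h * \<epsilon>')" by (intro sum_norm_le step) auto
    also have "\<dots> = (b - a) * \<epsilon>'" by (simp add: h(3)[symmetric])
    also have "\<dots> < \<epsilon>" using assms(1) \<open>\<epsilon> > 0\<close> by (simp add: \<epsilon>'_def field_simps)
    finally show ?thesis by (simp add: h_def x_def)
  qed
  then show "\<exists>no. \<forall>n\<ge>no. norm ((\<Sum>k<n. ((b - a) / real n) *\<^sub>R f (a + real k * ((b - a) / real n))) - (F b - F a)) < \<epsilon>"
    by blast
qed

text \<open>Averaging the flow over time gives a holomorphic map \<open>Z\<close> with
  \<open>\<delta> * Z (e u) = integral {u..u + \<delta>} e\<close>, and differentiating in \<open>u\<close> turns the translations into a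
  holomorphic vector field. The average is a Montel limit of finite averages, so no
  regularity of \<open>T v z\<close> in \<open>v\<close> is needed.\<close>

lemma flow_imp_vector_field:
  fixes e :: "real \<Rightarrow> complex"
  assumes pos: "\<delta> > 0" "\<eta> > 0" "r > 0"
    and e_cont: "continuous_on {-\<eta>..\<delta> + \<eta>} e" and e_ne: "e \<delta> \<noteq> e 0"
    and e_der: "\<And>u. \<bar>u\<bar> < \<eta> \<Longrightarrow> (e has_vector_derivative e' u) (at u)"
    and e_ball: "\<And>u. \<bar>u\<bar> < \<eta> \<Longrightarrow> e u \<in> ball (e 0) r"
    and T_hol: "\<And>v. v \<in> {0..\<delta>} \<Longrightarrow> T v holomorphic_on ball (e 0) r"
    and T_bound: "\<And>v z. v \<in> {0..\<delta>} \<Longrightarrow> z \<in> ball (e 0) r \<Longrightarrow> norm (T v z) \<le> M"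
    and T_flow: "\<And>u v. v \<in> {0..\<delta>} \<Longrightarrow> \<bar>u\<bar> < \<eta> \<Longrightarrow> T v (e u) = e (u + v)"
  obtains \<Psi> A where "open A" "e 0 \<in> A" "\<Psi> holomorphic_on A"
    "\<And>u. \<bar>u\<bar> < \<eta> \<Longrightarrow> e u \<in> A \<Longrightarrow> \<Psi> (e u) * e' u = 1"
proof -
  define B where "B = ball (e 0) r"
  obtain E where E: "\<And>x. x \<in> {-\<eta>..\<delta> + \<eta>} \<Longrightarrow> (E has_vector_derivative e x) (at x within {-\<eta>..\<delta> + \<eta>})"
    using antiderivative_continuous[OF e_cont] by blast
  \<comment> \<open>Riemann sums of \<open>T v z\<close> in v, so approximations of \<delta> times
    the average.\<close>
  define Z where "Z n z = (\<Sum>k<n. (\<delta> / real n) *\<^sub>R T (real k * (\<delta> / real n)) z)" for n :: nat and z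
  have mem: "real k * (\<delta> / real n) \<in> {0..\<delta>}" if "k < n" for k n :: nat
    using that pos by (auto simp: field_simps)
  have Z_hol: "Z n holomorphic_on B" for n
    unfolding Z_def scaleR_conv_of_real B_def
    by (intro holomorphic_intros T_hol mem) auto
  have Z_bound: "norm (Z n z) \<le> \<delta> * M" if "z \<in> B" for n z
  proof -
    have "M \<ge> 0" using T_bound[of 0 z] that pos norm_ge_zero[of "T 0 z"] unfolding B_def
      by (meson atLeastAtMost_iff less_imp_le order_refl order_trans)
    have "norm (Z n z) \<le> (\<Sum>k<n. (\<delta> / real n) * M)" unfolding Z_def
    proof (rule sum_norm_le)
      fix k assume "k \<in> {..<n}"
      then have "norm (T (real k * (\<delta> / real n)) z) \<le> M" using that mem by (intro T_bound) (auto simp: B_def)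
      then show "norm ((\<delta> / real n) *\<^sub>R T (real k * (\<delta> / real n)) z) \<le> (\<delta> / real n) * M"
        using pos by (simp add: mult_left_mono divide_right_mono)
    qed
    also have "\<dots> \<le> \<delta> * M" using pos \<open>M \<ge> 0\<close> by simp
    finally show ?thesis .
  qed
  obtain Zl k where Zl: "Zl holomorphic_on B" and k: "strict_mono (k :: nat \<Rightarrow> nat)"
    and lim: "\<And>z. z \<in> B \<Longrightarrow> (\<lambda>n. Z (k n) z) \<longlonglongrightarrow> Zl z"
    using Montel[of B "range Z" Z] Z_hol Z_bound
    by (smt (verit, best) B_def imageE open_ball order_refl subsetD)
  \<comment> \<open>On the curve these are Riemann sums of e from u to u + \<delta>. There the whole
    sequence converges, which determines the limit of the subsequence.\<close>
  have Zl_eq: "Zl (e u) = E (u + \<delta>) - E u" if u: "\<bar>u\<bar> < \<eta>" for u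
  proof -
    have sub: "{u..u + \<delta>} \<subseteq> {-\<eta>..\<delta> + \<eta>}" using u by auto
    have "(\<lambda>n. \<Sum>k<n. ((u + \<delta> - u) / real n) *\<^sub>R e (u + real k * ((u + \<delta> - u) / real n))) \<longlonglongrightarrow> E (u + \<delta>) - E u"
    proof (rule equidistant_sums_tendsto)
      show "(E has_vector_derivative e x) (at x within {u..u + \<delta>})" if "x \<in> {u..u + \<delta>}" for x
        using that E sub by (meson has_vector_derivative_within_subset subsetD)
    qed (use pos sub e_cont in \<open>auto intro: continuous_on_subset\<close>)
    moreover have "(\<Sum>k<n. ((u + \<delta> - u) / real n) *\<^sub>R e (u + real k * ((u + \<delta> - u) / real n))) = Z n (e u)" for n
      unfolding Z_def using u mem T_flow by (intro sum.cong) auto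
    ultimately have "(\<lambda>n. Z n (e u)) \<longlonglongrightarrow> E (u + \<delta>) - E u" by simp
    then have "(\<lambda>n. Z (k n) (e u)) \<longlonglongrightarrow> E (u + \<delta>) - E u"
      using k by (rule LIMSEQ_subseq_LIMSEQ[unfolded o_def])
    then show ?thesis using lim[of "e u"] e_ball[OF u] LIMSEQ_unique unfolding B_def by blast
  qed
  have key: "deriv Zl (e u) * e' u = e (u + \<delta>) - e u" if u: "\<bar>u\<bar> < \<eta>" for u
  proof -
    have Eder: "(E has_vector_derivative e x) (at x)" if "x \<in> {-\<eta><..<\<delta> + \<eta>}" for x
      using E[of x] that at_within_Icc_at[of "-\<eta>" x "\<delta> + \<eta>"] by auto
    have "(Zl has_field_derivative deriv Zl (e u)) (at (e u))"
      using Zl e_ball[OF u] by (intro holomorphic_derivI[of _ B]) (auto simp: B_def)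
    from field_vector_diff_chain_at[OF e_der[OF u] this]
    have 1: "((\<lambda>u. Zl (e u)) has_vector_derivative e' u * deriv Zl (e u)) (at u)" by (simp add: o_def)
    have "((\<lambda>u. E (u + \<delta>)) has_vector_derivative e (u + \<delta>)) (at u)"
    proof -
      have "((\<lambda>u. u + \<delta>) has_vector_derivative 1) (at u)" by (auto intro!: derivative_eq_intros)
      from vector_diff_chain_at[OF this Eder[of "u + \<delta>"]] show ?thesis using u pos by (simp add: o_def abs_less_iff)
    qed
    then have "((\<lambda>u. E (u + \<delta>) - E u) has_vector_derivative e (u + \<delta>) - e u) (at u)"
      using u pos by (intro has_vector_derivative_diff Eder) auto
    then have "((\<lambda>u. Zl (e u)) has_vector_derivative e (u + \<delta>) - e u) (at u)"
      by (rule has_vector_derivative_transform_within_open[of _ _ _ "{-\<eta><..<\<eta>}"]) (use u Zl_eq in auto)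
    with 1 show ?thesis using vector_derivative_unique_at by (metis mult.commute)
  qed
  \<comment> \<open>Fixed points of \<open>T \<delta>\<close> are the possible poles of the
    reciprocal vector field and are removed; \<open>e 0\<close> remains because
    \<open>e \<delta> \<noteq> e 0\<close>.\<close>
  define A where "A = B \<inter> (\<lambda>z. T \<delta> z - z) -` (-{0})"
  have T\<delta>: "T \<delta> holomorphic_on B" using T_hol[of \<delta>] pos by (simp add: B_def)
  have "open A" unfolding A_def
    by (intro continuous_open_preimage holomorphic_on_imp_continuous_on holomorphic_intros T\<delta>) (auto simp: B_def)
  moreover have "e 0 \<in> A" using T_flow[of \<delta> 0] pos e_ne by (simp add: A_def B_def)
  moreover have "(\<lambda>z. deriv Zl z / (T \<delta> z - z)) holomorphic_on A"
    using \<open>open A\<close> by (intro holomorphic_intros holomorphic_deriv holomorphic_on_subset[OF T\<delta>] holomorphic_on_subset[OF Zl])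
       (auto simp: A_def)
  moreover have "deriv Zl (e u) / (T \<delta> (e u) - e u) * e' u = 1" if "\<bar>u\<bar> < \<eta>" "e u \<in> A" for u
  proof -
    have "T \<delta> (e u) = e (u + \<delta>)" using T_flow[of \<delta> u] that pos by simp
    moreover have "T \<delta> (e u) \<noteq> e u" using that by (auto simp: A_def)
    ultimately show ?thesis using key[OF that(1)] by simp
  qed
  ultimately show ?thesis by (rule that)
qed

subsection \<open>Uniform families of germs\<close>

text \<open>If no \<open>F i\<close> had interior points in the interval, the relative complements
  would be open and dense with empty intersection.\<close>

lemma Baire_interval:
  fixes F :: "'i::countable \<Rightarrow> real set"
  assumes "a < b" "\<And>i. closed (F i)" "{a..b} \<subseteq> (\<Union>i. F i)"
  obtains i t e where "e > 0" "ball t e \<subseteq> F i" "ball t e \<subseteq> {a..b}"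
proof -
  have "\<exists>i. \<not> {a..b} \<subseteq> closure ({a..b} - F i)"
  proof (rule ccontr)
    assume *: "\<not> (\<exists>i. \<not> {a..b} \<subseteq> closure ({a..b} - F i))"
    have "{a..b} \<subseteq> closure (\<Inter>(range (\<lambda>i. {a..b} - F i)))"
    proof (rule Baire)
      fix T assume "T \<in> range (\<lambda>i. {a..b} - F i)"
      then obtain i where "T = {a..b} - F i" by auto
      moreover have "openin (top_of_set {a..b}) ({a..b} \<inter> - F i)"
        using assms(2)[of i] by (intro openin_open_Int) auto
      ultimately show "openin (top_of_set {a..b}) T \<and> {a..b} \<subseteq> closure T"
        using * by (simp add: Diff_eq)
    qed auto
    moreover have "(\<Inter>(range (\<lambda>i. {a..b} - F i))) = {}" using assms(3) by auto
    ultimately have "{a..b} \<subseteq> closure {}" by metis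
    then show False using assms(1) by auto
  qed
  then obtain i t1 where t1: "t1 \<in> {a..b}" "t1 \<notin> closure ({a..b} - F i)" by blast
  then obtain d where d: "d > 0" "\<And>y. y \<in> {a..b} - F i \<Longrightarrow> dist y t1 \<ge> d"
    unfolding closure_approachable by (meson not_le)
  \<comment> \<open>\<open>t1\<close> may be an endpoint; a nearby inner point leaves room for a
    ball of the line.\<close>
  have "t1 \<in> closure {a<..<b}" using t1(1) assms(1) by (simp add: closure_greaterThanLessThan)
  then obtain t where t: "t \<in> {a<..<b}" "dist t t1 < d" using d(1) unfolding closure_approachable by blast
  have "open ({a<..<b} \<inter> ball t1 d)" by auto
  moreover have "t \<in> {a<..<b} \<inter> ball t1 d" using t by (simp add: dist_commute)
  ultimately obtain e where e: "e > 0" "ball t e \<subseteq> {a<..<b} \<inter> ball t1 d" by (meson open_contains_ball)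
  have "ball t e \<subseteq> F i"
  proof
    fix y assume "y \<in> ball t e"
    then have "y \<in> {a..b}" "dist y t1 < d" using e by (auto simp: dist_commute subset_iff)
    then show "y \<in> F i" using d(2)[of y] by force
  qed
  moreover have "ball t e \<subseteq> {a..b}" using e(2) by (auto simp: subset_iff)
  ultimately show ?thesis using that e(1) by blast
qed

text \<open>Cauchy's inequality on circles of radius r / 4 around points of the half ball. The
  constant depends only on M and r, so it serves a whole family of maps.\<close>

lemma bounded_holomorphic_Lipschitz:
  assumes "f holomorphic_on ball p r" "\<And>z. z \<in> ball p r \<Longrightarrow> norm (f z) \<le> M"
    and "z \<in> ball p (r / 2)" "w \<in> ball p (r / 2)"
  shows "norm (f z - f w) \<le> 4 * M / r * norm (z - w)"
proof (rule field_differentiable_bound[where S = "ball p (r / 2)" and f' = "deriv f"])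
  have r: "r > 0" using assms(3) by (metis ball_empty empty_iff half_gt_zero_iff not_le)
  fix x assume x: "x \<in> ball p (r / 2)"
  have sub: "cball x (r / 4) \<subseteq> ball p r"
  proof
    fix y assume "y \<in> cball x (r / 4)"
    then have "dist p y < r" using dist_triangle[of p y x] x r by (auto simp: field_simps)
    then show "y \<in> ball p r" by simp
  qed
  have "x \<in> ball p r" using x r by auto
  then have "(f has_field_derivative deriv f x) (at x)"
    using assms(1) by (intro holomorphic_derivI[of f "ball p r"]) auto
  then show "(f has_field_derivative deriv f x) (at x within ball p (r / 2))"
    by (rule has_field_derivative_at_within)
  have "norm ((deriv ^^ 1) f x) \<le> fact 1 * M / (r / 4) ^ 1"
  proof (rule Cauchy_inequality)
    have "ball x (r / 4) \<subseteq> ball p r" using sub by auto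
    then show "f holomorphic_on ball x (r / 4)" using assms(1) by (meson holomorphic_on_subset)
    show "continuous_on (cball x (r / 4)) f"
      using assms(1) sub by (meson continuous_on_subset holomorphic_on_imp_continuous_on)
    show "norm (f y) \<le> M" if "norm (x - y) = r / 4" for y
      using that sub by (intro assms(2)) (auto simp: dist_norm)
  qed (use r in auto)
  then show "norm (deriv f x) \<le> 4 * M / r" by (simp add: field_simps)
qed (use assms in auto)

context parametrized_arc
begin

text \<open>Following one germ by an inverse of the other gives an isotropy germ with multiplier m /
  n.\<close>

lemma germ_multiplier_unique:
  assumes "germ s t m g" "germ s t n h" "\<not> straight \<gamma> (c s)"
  shows "\<bar>m\<bar> = \<bar>n\<bar>"
proof -
  obtain k where "germ t s (1 / n) k" using germ_inverse[OF assms(2)] .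
  then have "\<bar>1 / n * m\<bar> = 1" using germ_compose[OF assms(1)] isotropy_multiplier assms(3) by blast
  moreover have "n \<noteq> 0" using assms(2) by (simp add: germ_def)
  ultimately show ?thesis by (simp add: field_simps abs_mult)
qed

text \<open>The sign \<open>\<epsilon>\<close> fixes the orientation of the germ. All conditions survive locally uniform limits
  with \<open>n\<close> fixed: the lower bound on the multiplier keeps the limit nonconstant, hence injective.\<close>

definition admissible ::
    "real set \<Rightarrow> real \<Rightarrow> nat \<Rightarrow> real \<Rightarrow> real \<Rightarrow> real \<Rightarrow> (complex \<Rightarrow> complex) \<Rightarrow> bool" where
  "admissible K x n \<epsilon> t m g \<longleftrightarrow> (let B = ball (c x) (1 / Suc n) in
     g holomorphic_on B \<and> inj_on g B \<and> (\<forall>z\<in>B. norm (g z) \<le> Suc n) \<and> g (c x) = c t \<and>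
     g ` (\<gamma> \<inter> B) \<subseteq> c ` K \<and> deriv g (c x) * c' x = of_real m * c' t \<and> \<epsilon> * m \<ge> 1 / Suc n)"

lemma admissible_germ:
  assumes "admissible K x n \<epsilon> t m g" "x \<in> I" "t \<in> I" "K \<subseteq> I"
  shows "germ x t m g"
proof -
  have "\<epsilon> * m > 0" using assms(1)
    by (auto simp: admissible_def Let_def intro: less_le_trans[of _ "1 / real (Suc n)"])
  then have "m \<noteq> 0" by auto
  moreover have "c ` K \<subseteq> \<gamma>" using assms(4) c_mem by blast
  moreover have "g ` (\<gamma> \<inter> ball (c x) (1 / Suc n)) \<subseteq> c ` K"
    using assms(1) unfolding admissible_def Let_def by blast
  ultimately have "g ` (\<gamma> \<inter> ball (c x) (1 / Suc n)) \<subseteq> \<gamma>" by blast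
  moreover have "c x \<in> ball (c x) (1 / Suc n)" by simp
  ultimately show ?thesis using assms \<open>m \<noteq> 0\<close> unfolding admissible_def Let_def germ_def
    by (meson open_ball)
qed

text \<open>Montel supplies the limit map and Hurwitz its injectivity. Values on the curve are kept
  in the compact image of K because the curve is only locally closed, and a limit of its points may
  leave it.\<close>

lemma admissible_limit:
  assumes adm: "\<And>j. admissible K x n \<epsilon> (t j) (m j) (g j)" and lim: "t \<longlonglongrightarrow> l"
    and "x \<in> I" "l \<in> I" "K \<subseteq> I" "compact K"
  obtains m' g' k where "strict_mono (k :: nat \<Rightarrow> nat)" "admissible K x n \<epsilon> l m' g'" "(\<lambda>j. m (k j)) \<longlonglongrightarrow> m'"
proof -
  define R where "R = 1 / real (Suc n)"
  define B where "B = ball (c x) R"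
  have R: "R > 0" by (simp add: R_def)
  have g: "g j holomorphic_on B" "inj_on (g j) B" "\<And>z. z \<in> B \<Longrightarrow> norm (g j z) \<le> Suc n" "g j (c x) = c (t j)"
    "g j ` (\<gamma> \<inter> B) \<subseteq> c ` K" "deriv (g j) (c x) * c' x = of_real (m j) * c' (t j)" "\<epsilon> * m j \<ge> R" for j
    using adm[of j] by (auto simp: admissible_def Let_def R_def B_def)
  obtain g' k where g': "g' holomorphic_on B" and k: "strict_mono (k :: nat \<Rightarrow> nat)"
    and pt: "\<And>z. z \<in> B \<Longrightarrow> (\<lambda>j. g (k j) z) \<longlonglongrightarrow> g' z"
    and unif: "\<And>K. compact K \<Longrightarrow> K \<subseteq> B \<Longrightarrow> uniform_limit K (g \<circ> k) g' sequentially"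
    using Montel[of B "range g" g] g(1,3) by (smt (verit, best) B_def imageE open_ball order_refl subsetD)
  have cxB: "c x \<in> B" using R by (simp add: B_def)
  have tk: "(\<lambda>j. t (k j)) \<longlonglongrightarrow> l" using lim k by (rule LIMSEQ_subseq_LIMSEQ[unfolded o_def])
  have "(\<lambda>j. (deriv ^^ 1) ((g \<circ> k) j) (c x)) \<longlonglongrightarrow> (deriv ^^ 1) g' (c x)"
  proof (rule higher_deriv_complex_uniform_limit)
    have "cball (c x) (R / 2) \<subseteq> B" using R by (auto simp: B_def)
    then show "uniform_limit (ball (c x) (R / 2)) (g \<circ> k) g' sequentially"
      using unif[of "cball (c x) (R / 2)"] by (auto intro: uniform_limit_on_subset)
    have "ball (c x) (R / 2) \<subseteq> B" using R by (auto simp: B_def)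
    then show "\<forall>\<^sub>F j in sequentially. (g \<circ> k) j holomorphic_on ball (c x) (R / 2)"
      using g(1) by (intro always_eventually allI) (auto intro: holomorphic_on_subset)
  qed (use R in auto)
  then have dlim: "(\<lambda>j. deriv (g (k j)) (c x)) \<longlonglongrightarrow> deriv g' (c x)" by simp
  have "isCont c' l" using c'_cont I assms(4) by (meson continuous_on_eq_continuous_at)
  then have c'lim: "(\<lambda>j. c' (t (k j))) \<longlonglongrightarrow> c' l" using tk by (rule isCont_tendsto_compose)
  have "(\<lambda>j. deriv (g (k j)) (c x) * c' x / c' (t (k j))) \<longlonglongrightarrow> deriv g' (c x) * c' x / c' l"
    using c'_nonzero[OF assms(4)] by (intro tendsto_intros dlim c'lim)
  moreover have "\<forall>\<^sub>F j in sequentially. t (k j) \<in> I"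
    using topological_tendstoD[OF tk I assms(4)] .
  then have "\<forall>\<^sub>F j in sequentially. deriv (g (k j)) (c x) * c' x / c' (t (k j)) = of_real (m (k j))"
    by eventually_elim (use g(6) c'_nonzero in \<open>simp add: field_simps\<close>)
  ultimately have mlim: "(\<lambda>j. complex_of_real (m (k j))) \<longlonglongrightarrow> deriv g' (c x) * c' x / c' l"
    by (rule Lim_transform_eventually)
  have "deriv g' (c x) * c' x / c' l \<in> \<real>"
    by (rule closed_sequentially[OF closed_complex_Reals _ mlim]) auto
  then obtain m' where m': "deriv g' (c x) * c' x / c' l = of_real m'" by (auto elim: Reals_cases)
  have mlim': "(\<lambda>j. m (k j)) \<longlonglongrightarrow> m'" using mlim unfolding m' by (simp only: tendsto_of_real_iff)
  have "\<epsilon> * m' \<ge> R"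
    by (rule LIMSEQ_le_const[OF tendsto_mult_left[OF mlim']]) (use g(7) in auto)
  then have "m' \<noteq> 0" using R by auto
  then have dg': "deriv g' (c x) \<noteq> 0" using m' by auto
  have "\<not> g' constant_on B"
  proof
    assume "g' constant_on B"
    then obtain y where "\<And>z. z \<in> B \<Longrightarrow> g' z = y" unfolding constant_on_def by blast
    then have "deriv g' (c x) = deriv (\<lambda>_. y) (c x)"
      using cxB by (intro complex_derivative_transform_within_open[OF g' _ _ cxB]) (auto simp: B_def)
    then show False using dg' by simp
  qed
  then have "inj_on g' B"
    using Hurwitz_injective[of B "g \<circ> k" g'] g(1,2) g' unif by (auto simp: B_def)
  moreover have "norm (g' z) \<le> Suc n" if "z \<in> B" for z
    using tendsto_norm[OF pt[OF that]] g(3)[OF that] by (intro LIMSEQ_le_const2) auto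
  moreover have "g' (c x) = c l"
  proof -
    have "(\<lambda>j. c (t (k j))) \<longlonglongrightarrow> c l" using tk c_isCont[OF assms(4)] by (rule isCont_tendsto_compose[rotated])
    then show ?thesis using pt[OF cxB] g(4) LIMSEQ_unique by fastforce
  qed
  moreover have "g' ` (\<gamma> \<inter> B) \<subseteq> c ` K"
  proof clarify
    fix z assume z: "z \<in> \<gamma>" "z \<in> B"
    have "closed (c ` K)"
      using assms(5,6) c_cont by (intro compact_imp_closed compact_continuous_image) (auto intro: continuous_on_subset)
    from closed_sequentially[OF this _ pt[OF z(2)]] show "g' z \<in> c ` K" using g(5) z by blast
  qed
  moreover have "deriv g' (c x) * c' x = of_real m' * c' l"
    using m' c'_nonzero[OF assms(4)] by (simp add: field_simps)
  ultimately have "admissible K x n \<epsilon> l m' g'"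
    using g' \<open>\<epsilon> * m' \<ge> R\<close> by (simp add: admissible_def Let_def B_def[symmetric] R_def[symmetric] del: of_nat_Suc)
  then show ?thesis using that k mlim' by blast
qed

text \<open>Every injective germ obeys the bounds for some n, and the pairs of n and a sign are
  countable, as Baire requires. The target lies in the interior of K so that the curve points of a
  small disc are mapped into the arc over K.\<close>

lemma admissible_exists:
  assumes "x \<in> I" "t \<in> interior K" "K \<subseteq> I"
    and "open A" "c x \<in> A" "g holomorphic_on A" "inj_on g A" "g ` (\<gamma> \<inter> A) \<subseteq> \<gamma>" "g (c x) = c t"
  obtains n \<epsilon> m where "\<epsilon> = 1 \<or> \<epsilon> = -1" "admissible K x n \<epsilon> t m g"
proof -
  have t: "t \<in> I" using assms(2,3) interior_subset by blast
  have "deriv g (c x) \<noteq> 0" using assms by (intro holomorphic_injective_imp_regular)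
  then obtain m where "germ x t m g" using germ_exists[OF assms(1) t assms(4,5,6,8,9)] by metis
  then have m: "m \<noteq> 0" "deriv g (c x) * c' x = of_real m * c' t" by (auto simp: germ_def)
  have "open (A \<inter> g -` (W \<inter> L -` (interior K)))"
    using assms by (intro continuous_open_preimage holomorphic_on_imp_continuous_on preimage_L_open) auto
  moreover have "c x \<in> A \<inter> g -` (W \<inter> L -` (interior K))" using assms t c_mem Lc by auto
  ultimately obtain r where r: "r > 0" "cball (c x) r \<subseteq> A \<inter> g -` (W \<inter> L -` (interior K))"
    by (meson open_contains_cball)
  have "compact (g ` cball (c x) r)"
    using r(2) assms(6) by (intro compact_continuous_image)
      (auto intro!: continuous_on_subset[OF holomorphic_on_imp_continuous_on])
  from compact_imp_bounded[OF this] obtain M where M: "\<And>z. z \<in> cball (c x) r \<Longrightarrow> norm (g z) \<le> M"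
    unfolding bounded_iff by blast
  obtain n :: nat where n: "max (max M (1 / r)) (1 / \<bar>m\<bar>) < real n" using reals_Archimedean2 by blast
  then have n': "M \<le> Suc n" "1 / r < Suc n" "1 / \<bar>m\<bar> < Suc n" by auto
  then have n: "M \<le> Suc n" "1 / Suc n < r" "1 / Suc n \<le> \<bar>m\<bar>"
    using r m by (auto simp: field_simps simp del: of_nat_Suc)
  have sub: "ball (c x) (1 / Suc n) \<subseteq> cball (c x) r" using n(2) by (auto simp del: of_nat_Suc)
  have "g ` (\<gamma> \<inter> ball (c x) (1 / Suc n)) \<subseteq> c ` K"
  proof clarify
    fix z assume z: "z \<in> \<gamma>" "z \<in> ball (c x) (1 / Suc n)"
    then have "z \<in> A \<inter> g -` (W \<inter> L -` (interior K))" using sub r(2) by blast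
    then have "g z \<in> \<gamma>" "g z \<in> W" "L (g z) \<in> K" using z(1) assms(8) interior_subset by blast+
    then show "g z \<in> c ` K" using cL(1) by (metis imageI)
  qed
  moreover have "g holomorphic_on ball (c x) (1 / Suc n)" "inj_on g (ball (c x) (1 / Suc n))"
    using assms(6,7) sub r(2) by (blast intro: holomorphic_on_subset inj_on_subset)+
  moreover have "norm (g z) \<le> Suc n" if "z \<in> ball (c x) (1 / Suc n)" for z
    using that sub M n(1) by (meson order_trans subsetD)
  moreover have "sgn m * m \<ge> 1 / Suc n" using n(3) by (simp add: sgn_mult_self_eq abs_sgn mult.commute)
  ultimately have "admissible K x n (sgn m) t m g"
    using m assms(9) unfolding admissible_def Let_def by blast
  then show ?thesis using that[of "sgn m"] m(1) by (auto simp: sgn_if)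
qed

section \<open>The density invariant under germs and its arc length\<close>

text \<open>The germs are chosen independently for each t, yet the modulus cannot jump: for
  parameters tending to l, a subsequence of multipliers converges to that of a germ ending at l, and
  uniqueness gives it the modulus of the chosen one.\<close>

lemma continuous_on_abs_multiplier:
  assumes adm: "\<And>t. t \<in> J \<Longrightarrow> admissible K x n \<epsilon> t (\<mu> t) (\<psi> t)"
    and "x \<in> I" "J \<subseteq> I" "K \<subseteq> I" "compact K" "open J" "\<not> straight \<gamma> (c x)"
  shows "continuous_on J (\<lambda>t. \<bar>\<mu> t\<bar>)"
proof (rule continuous_at_imp_continuous_on, rule ballI, rule ccontr)
  fix l assume l: "l \<in> J" "\<not> isCont (\<lambda>t. \<bar>\<mu> t\<bar>) l"
  then obtain e where e: "e > 0" "\<And>d. d > 0 \<Longrightarrow> \<exists>t. dist t l < d \<and> \<not> dist \<bar>\<mu> t\<bar> \<bar>\<mu> l\<bar> < e"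
    unfolding continuous_at_eps_delta by metis
  obtain d0 where d0: "d0 > 0" "ball l d0 \<subseteq> J" using assms(6) l(1) by (meson open_contains_ball)
  have "\<forall>j :: nat. \<exists>t. dist t l < min d0 (1 / Suc j) \<and> \<not> dist \<bar>\<mu> t\<bar> \<bar>\<mu> l\<bar> < e"
    by (intro allI e(2)) (use d0(1) in simp)
  then obtain t where t: "\<And>j :: nat. dist (t j) l < min d0 (1 / Suc j)" "\<And>j. \<not> dist \<bar>\<mu> (t j)\<bar> \<bar>\<mu> l\<bar> < e"
    by metis
  have tJ: "t j \<in> J" for j using t(1)[of j] d0(2) by (auto simp: dist_commute subset_iff)
  have "t \<longlonglongrightarrow> l"
  proof (rule metric_LIMSEQ_I)
    fix r :: real assume "r > 0"
    then obtain N where N: "1 / real (Suc N) < r" using nat_approx_posE by blast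
    have "dist (t j) l < r" if "j \<ge> N" for j
    proof -
      have "1 / real (Suc j) \<le> 1 / real (Suc N)" using that by (intro divide_left_mono) auto
      then show ?thesis using t(1)[of j] N by linarith
    qed
    then show "\<exists>no. \<forall>j\<ge>no. dist (t j) l < r" by blast
  qed
  have "l \<in> I" using l(1) assms(3) by blast
  from admissible_limit[OF adm[OF tJ] \<open>t \<longlonglongrightarrow> l\<close> assms(2) this assms(4,5)]
  obtain m' g' k where lim: "strict_mono (k :: nat \<Rightarrow> nat)" "admissible K x n \<epsilon> l m' g'"
    "(\<lambda>j. \<mu> (t (k j))) \<longlonglongrightarrow> m'" .
  have "germ x l m' g'" "germ x l (\<mu> l) (\<psi> l)"
    using admissible_germ[OF _ assms(2) \<open>l \<in> I\<close> assms(4)] lim(2) adm[OF l(1)] by blast+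
  then have "\<bar>m'\<bar> = \<bar>\<mu> l\<bar>" using assms(7) by (rule germ_multiplier_unique)
  then have "(\<lambda>j. \<bar>\<mu> (t (k j))\<bar>) \<longlonglongrightarrow> \<bar>\<mu> l\<bar>" using tendsto_rabs[OF lim(3)] by simp
  then obtain j where "dist \<bar>\<mu> (t (k j))\<bar> \<bar>\<mu> l\<bar> < e" using e(1) unfolding lim_sequentially by blast
  then show False using t(2) by blast
qed

text \<open>The density \<open>1 / |\<mu>|\<close> is invariant under all germs, since the moduli of multipliers depend
  only on the endpoints. In the arc length parameter of this density the germs act by translations.\<close>

lemma translations_imp_straight:
  assumes adm: "\<And>t. t \<in> ball t0 (2 * \<eta>) \<Longrightarrow> admissible K x n \<epsilon> t (\<mu> t) (\<psi> t)"
    and "\<eta> > 0" and x: "x \<in> I" and JI: "cball t0 (2 * \<eta>) \<subseteq> I" and K: "K \<subseteq> I" "compact K"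
    and ns: "\<not> straight \<gamma> (c x)"
  shows "straight \<gamma> (c t0)"
proof -
  define J where "J = ball t0 (2 * \<eta>)"
  have J: "open J" "J \<subseteq> I" "t0 \<in> J" "connected J" using assms(2) JI by (auto simp: J_def)
  have adm: "admissible K x n \<epsilon> t (\<mu> t) (\<psi> t)" if "t \<in> J" for t using that adm by (simp add: J_def)
  have t0: "t0 \<in> I" using J by auto
  have g\<psi>: "germ x t (\<mu> t) (\<psi> t)" if "t \<in> J" for t
    using admissible_germ[OF adm[OF that]] x J K that by auto
  define \<nu> where "\<nu> t = \<bar>\<mu> t\<bar>" for t
  have \<nu>_pos: "\<nu> t > 0" if "t \<in> J" for t using g\<psi>[OF that] by (simp add: \<nu>_def germ_def)
  have \<nu>_cont: "continuous_on J \<nu>"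
    unfolding \<nu>_def using continuous_on_abs_multiplier[OF adm x] J K ns by blast
  \<comment> \<open>Composed with \<open>\<psi> s\<close>, a germ from s to t becomes a second germ
    from x to t.\<close>
  have \<nu>_germ: "\<bar>m\<bar> * \<nu> s = \<nu> t" if "germ s t m g" "s \<in> J" "t \<in> J" for s t m g
    using germ_multiplier_unique[OF germ_compose[OF g\<psi>[OF that(2)] that(1)] g\<psi>[OF that(3)] ns]
    by (simp add: \<nu>_def abs_mult)
  \<comment> \<open>The common sign \<epsilon> makes the maps \<open>T t\<close> below preserve
    orientation; a reversing one would act on arc length as a reflection instead of a
    translation.\<close>
  have sign: "\<mu> t / \<mu> t0 > 0" if "t \<in> J" for t
  proof -
    have "\<epsilon> * \<mu> t > 0" "\<epsilon> * \<mu> t0 > 0"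
      using adm[OF that] adm[OF J(3)]
      by (auto simp: admissible_def Let_def intro: less_le_trans[of _ "1 / real (Suc n)"])
    then show ?thesis by (auto simp: zero_less_mult_iff zero_less_divide_iff)
  qed
  have "continuous_on {t0 - \<eta>..t0 + \<eta>} (\<lambda>t. 1 / \<nu> t)"
  proof (intro continuous_on_divide continuous_on_const continuous_on_subset[OF \<nu>_cont])
    show sub: "{t0 - \<eta>..t0 + \<eta>} \<subseteq> J" using assms(2) by (auto simp: J_def dist_real_def)
    show "\<forall>t\<in>{t0 - \<eta>..t0 + \<eta>}. \<nu> t \<noteq> 0" using sub \<nu>_pos by force
  qed
  then obtain S0 where S0: "\<And>t. t \<in> {t0 - \<eta>..t0 + \<eta>} \<Longrightarrow>
      (S0 has_vector_derivative 1 / \<nu> t) (at t within {t0 - \<eta>..t0 + \<eta>})"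
    using antiderivative_continuous by blast
  define J1 where "J1 = ball t0 \<eta>"
  have J1: "open J1" "J1 \<subseteq> J" "t0 \<in> J1" "connected J1" using assms(2) by (auto simp: J1_def J_def)
  define S where "S t = S0 t - S0 t0" for t
  have S: "(S has_real_derivative 1 / \<nu> t) (at t)" if "t \<in> J1" for t
  proof -
    have "t \<in> {t0 - \<eta><..<t0 + \<eta>}" using that by (auto simp: J1_def dist_real_def)
    then have "(S0 has_vector_derivative 1 / \<nu> t) (at t)"
      using S0[of t] at_within_Icc_at[of "t0 - \<eta>" t "t0 + \<eta>"] by auto
    then show ?thesis unfolding S_def
      by (auto simp: has_real_derivative_iff_has_vector_derivative[symmetric] intro!: derivative_eq_intros)
  qed
  have S_t0: "S t0 = 0" by (simp add: S_def)
  have S_mono: "S u < S v" if "u \<in> J1" "v \<in> J1" "u < v" for u v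
  proof (rule DERIV_pos_imp_increasing[OF that(3)])
    fix y assume "u \<le> y" "y \<le> v"
    then have "y \<in> J1" using that by (auto simp: J1_def dist_real_def)
    then show "\<exists>d. (S has_real_derivative d) (at y) \<and> d > 0" using S \<nu>_pos J1(2) by (metis subsetD zero_less_divide_1_iff)
  qed
  then have S_inj: "inj_on S J1" by (metis inj_onI less_irrefl linorder_neqE)
  have S_cont: "continuous_on J1 S" using S by (meson DERIV_isCont continuous_at_imp_continuous_on)
  define R where "R = inv_into J1 S"
  have RS: "R (S t) = t" if "t \<in> J1" for t using that S_inj by (simp add: R_def)
  have R_der: "(R has_real_derivative \<nu> t) (at (S t))" if "t \<in> J1" for t
    unfolding has_field_derivative_def
  proof (rule has_derivative_inverse_on[OF J1(1) _ _ _ that, where f = S and f' = "\<lambda>t. (*) (1 / \<nu> t)"])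
    show "(S has_derivative (*) (1 / \<nu> y)) (at y)" if "y \<in> J1" for y
      using S[OF that] by (simp add: has_field_derivative_def)
    show "(*) (1 / \<nu> t) \<circ> (*) (\<nu> t) = id" using \<nu>_pos[of t] that J1(2) by (auto simp: fun_eq_iff)
  qed (rule RS)

  obtain h where h: "germ t0 x (1 / \<mu> t0) h" using germ_inverse[OF g\<psi>[OF J(3)]] .
  then obtain A where A: "open A" "c t0 \<in> A" "h holomorphic_on A" "h ` (\<gamma> \<inter> A) \<subseteq> \<gamma>"
    and hc: "h (c t0) = c x" and hm: "deriv h (c t0) * c' t0 = of_real (1 / \<mu> t0) * c' x" "\<mu> t0 \<noteq> 0"
    unfolding germ_def by auto
  define B0 where "B0 = ball (c x) (1 / Suc n)"
  have "open (A \<inter> h -` B0)"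
    using A by (intro continuous_open_preimage holomorphic_on_imp_continuous_on) (auto simp: B0_def)
  moreover have "c t0 \<in> A \<inter> h -` B0" using A hc by (simp add: B0_def)
  moreover have "h holomorphic_on A \<inter> h -` B0" using A(3) by (auto intro: holomorphic_on_subset)
  moreover have "deriv h (c t0) \<noteq> 0" using hm c'_nonzero[OF x] by auto
  ultimately obtain r where r: "r > 0" "ball (c t0) r \<subseteq> A \<inter> h -` B0" "inj_on h (ball (c t0) r)"
    using has_complex_derivative_locally_injective by blast
  define B where "B = ball (c t0) r"
  have B: "open B" "c t0 \<in> B" "B \<subseteq> A" "h ` B \<subseteq> B0" "inj_on h B" using r by (auto simp: B_def)
  \<comment> \<open>\<open>h\<close> is fixed and only \<open>\<psi> t\<close> varies, so all
    \<open>T t\<close> share the domain B and the bound \<open>Suc n\<close>.\<close>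
  define T where "T t = \<psi> t \<circ> h" for t
  have \<psi>: "\<psi> t holomorphic_on B0" "inj_on (\<psi> t) B0" "\<And>z. z \<in> B0 \<Longrightarrow> norm (\<psi> t z) \<le> Suc n"
    "\<psi> t (c x) = c t" "\<psi> t ` (\<gamma> \<inter> B0) \<subseteq> c ` K" if "t \<in> J" for t
    using adm[OF that] by (auto simp: admissible_def Let_def B0_def)
  have T_hol: "T t holomorphic_on B" if "t \<in> J" for t
    unfolding T_def using \<psi>(1)[OF that] A(3) B(3,4)
    by (meson holomorphic_on_compose_gen holomorphic_on_subset)
  have T_inj: "inj_on (T t) B" if "t \<in> J" for t
    unfolding T_def using \<psi>(2)[OF that] B(4,5) by (meson comp_inj_on inj_on_subset)
  have T_bound: "norm (T t z) \<le> Suc n" if "t \<in> J" "z \<in> B" for t z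
    unfolding T_def o_def using \<psi>(3)[OF that(1)] B(4) that(2) by blast
  have T_K: "T t z \<in> c ` K" if "t \<in> J" "z \<in> \<gamma>" "z \<in> B" for t z
  proof -
    have "h z \<in> \<gamma> \<inter> B0" using that A(4) B(3,4) by blast
    then show ?thesis unfolding T_def o_def using \<psi>(5)[OF that(1)] by blast
  qed
  have cK: "c ` K \<subseteq> \<gamma>" "c ` K \<subseteq> W" using K c_mem by auto
  have T_germ: "germ t0 t (\<mu> t / \<mu> t0) (T t)" if "t \<in> J" for t
    using germ_compose[OF h g\<psi>[OF that]] by (simp add: T_def)
  have T_t0: "T t (c t0) = c t" if "t \<in> J" for t using T_germ[OF that] by (simp add: germ_def)

  have "compact (c ` K)" using K c_cont by (intro compact_continuous_image) (auto intro: continuous_on_subset)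
  then have "uniformly_continuous_on (c ` K) L"
    using L_cont cK by (intro compact_uniformly_continuous) (auto intro: continuous_on_subset)
  then obtain \<delta>0 where \<delta>0: "\<delta>0 > 0"
    "\<And>z w. z \<in> c ` K \<Longrightarrow> w \<in> c ` K \<Longrightarrow> dist w z < \<delta>0 \<Longrightarrow> dist (L w) (L z) < \<eta> / 2"
    unfolding uniformly_continuous_on_def using assms(2) by (metis half_gt_zero)
  \<comment> \<open>Chosen against the common Lipschitz constant 4 * Suc n / r: arc points within
    \<kappa> of \<open>c t0\<close> are sent by every \<open>T t\<close> to within
    \<open>\<delta>0\<close> of \<open>c t\<close>, hence to parameters within \<eta> / 2 of
    t.\<close>
  define \<kappa> where "\<kappa> = min (r / 2) (\<delta>0 * r / (4 * real (Suc n)))"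
  have \<kappa>: "\<kappa> > 0" using r \<delta>0 by (simp add: \<kappa>_def)
  have "open (J1 \<inter> (I \<inter> c -` ball (c t0) \<kappa>) \<inter> ball t0 (\<eta> / 2))"
    using J1 by (intro open_Int preimage_open) auto
  moreover have "t0 \<in> J1 \<inter> (I \<inter> c -` ball (c t0) \<kappa>) \<inter> ball t0 (\<eta> / 2)"
    using J1 t0 \<kappa> assms(2) by auto
  ultimately obtain \<rho> where \<rho>: "\<rho> > 0" "ball t0 \<rho> \<subseteq> J1 \<inter> (I \<inter> c -` ball (c t0) \<kappa>) \<inter> ball t0 (\<eta> / 2)"
    by (meson open_contains_ball)
  define N where "N = ball t0 \<rho>"
  have N: "open N" "connected N" "t0 \<in> N" "N \<subseteq> J1" "N \<subseteq> I" "c ` N \<subseteq> ball (c t0) \<kappa>" "N \<subseteq> ball t0 (\<eta> / 2)"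
    using \<rho> by (auto simp: N_def)
  have cNB: "c s \<in> B" if "s \<in> N" for s
    using N(6) that r(1) by (force simp: B_def \<kappa>_def)

  have trans: "L (T t (c s)) \<in> J1 \<and> T t (c s) = c (L (T t (c s))) \<and> S (L (T t (c s))) = S s + S t"
    if t: "t \<in> N" and s: "s \<in> N" for t s
  proof -
    have tJ: "t \<in> J" using t N J1 by blast
    define \<theta> where "\<theta> s = L (T t (c s))" for s
    have TK: "T t (c s) \<in> c ` K" if "s \<in> N" for s
      using T_K[OF tJ _ cNB[OF that]] c_mem that N by blast
    have c\<theta>: "c (\<theta> s) = T t (c s)" if "s \<in> N" for s
      unfolding \<theta>_def using TK[OF that] cK by (intro cL) auto
    have \<theta>t0: "\<theta> t0 = t" unfolding \<theta>_def using T_t0[OF tJ] Lc tJ J by auto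
    have \<theta>J1: "\<theta> s \<in> J1" if s: "s \<in> N" for s
    proof -
      have "c s \<in> ball (c t0) \<kappa>" using N s by blast
      then have "dist (c s) (c t0) < \<kappa>" by (simp add: dist_commute)
      then have cs: "c s \<in> ball (c t0) (r / 2)" "norm (c s - c t0) < \<delta>0 * r / (4 * real (Suc n))"
        by (auto simp: \<kappa>_def dist_commute dist_norm norm_minus_commute)
      have "norm (T t (c s) - T t (c t0)) \<le> 4 * real (Suc n) / r * norm (c s - c t0)"
        using T_hol[OF tJ] T_bound[OF tJ] cs(1) r(1)
        by (intro bounded_holomorphic_Lipschitz[where p = "c t0"]) (auto simp: B_def)
      also have "\<dots> < \<delta>0" using cs(2) r(1) by (simp add: field_simps)
      finally have "dist (T t (c s)) (T t (c t0)) < \<delta>0" by (simp add: dist_norm)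
      from \<delta>0(2)[OF TK[OF N(3)] TK[OF s] this]
      have "dist (\<theta> s) (\<theta> t0) < \<eta> / 2" unfolding \<theta>_def .
      moreover have "dist t0 t < \<eta> / 2" using t N(7) by auto
      ultimately show ?thesis unfolding \<theta>t0 J1_def mem_ball dist_real_def by linarith
    qed
    have T'nz: "deriv (T t) z \<noteq> 0" if "z \<in> B" for z
      using T_hol[OF tJ] T_inj[OF tJ] B(1) that by (intro holomorphic_injective_imp_regular)
    have "\<exists>m. germ s (\<theta> s) m (T t) \<and> (\<theta> has_real_derivative m) (at s)" if s: "s \<in> N" for s
    proof -
      have "T t ` (\<gamma> \<inter> B) \<subseteq> \<gamma>" using T_K[OF tJ] cK by blast
      then show ?thesis
        using germ_exists[of s "\<theta> s" B "T t"] s N \<theta>J1[OF s] J1 J B(1) cNB[OF s] T_hol[OF tJ] c\<theta>[OF s] T'nz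
        unfolding \<theta>_def by (metis subsetD)
    qed
    then obtain D where D: "germ s (\<theta> s) (D s) (T t)" "(\<theta> has_real_derivative D s) (at s)" if "s \<in> N" for s
      by metis
    have D_nz: "D s \<noteq> 0" if "s \<in> N" for s using D(1)[OF that] by (simp add: germ_def)
    have D_eq: "D s = Re (deriv (T t) (c s) * c' s / c' (\<theta> s))" if "s \<in> N" for s
    proof -
      have "\<theta> s \<in> I" "deriv (T t) (c s) * c' s = of_real (D s) * c' (\<theta> s)"
        using D(1)[OF that] by (auto simp: germ_def)
      then show ?thesis using c'_nonzero by simp
    qed
    have \<theta>_cont: "continuous_on N \<theta>" using D(2) by (meson DERIV_isCont continuous_at_imp_continuous_on)
    have "continuous_on N (\<lambda>s. Re (deriv (T t) (c s) * c' s / c' (\<theta> s)))"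
    proof (rule continuous_on_Re, rule continuous_on_divide, rule continuous_on_mult)
      show "continuous_on N (\<lambda>s. deriv (T t) (c s))"
        by (rule continuous_on_compose2[OF holomorphic_on_imp_continuous_on[OF holomorphic_deriv[OF T_hol[OF tJ] B(1)]]
              continuous_on_subset[OF c_cont N(5)]]) (use cNB in blast)
      show "continuous_on N c'" using c'_cont N(5) by (rule continuous_on_subset)
      show "continuous_on N (\<lambda>s. c' (\<theta> s))"
        by (rule continuous_on_compose2[OF c'_cont \<theta>_cont]) (use \<theta>J1 J1(2) J(2) in blast)
      show "\<forall>s\<in>N. c' (\<theta> s) \<noteq> 0" using \<theta>J1 J1(2) J(2) c'_nonzero by (meson subsetD)
    qed
    then have D_cont: "continuous_on N D" using D_eq by (subst continuous_on_cong[OF refl]) auto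
    have "D t0 = \<mu> t / \<mu> t0"
    proof -
      have "deriv (T t) (c t0) * c' t0 = of_real (D t0) * c' t"
        using D(1)[OF N(3)] unfolding \<theta>t0 germ_def by auto
      moreover have "deriv (T t) (c t0) * c' t0 = of_real (\<mu> t / \<mu> t0) * c' t"
        using T_germ[OF tJ] unfolding germ_def by auto
      moreover have "c' t \<noteq> 0" using c'_nonzero tJ J by blast
      ultimately have "complex_of_real (D t0) = of_real (\<mu> t / \<mu> t0)" by (metis mult_cancel_right)
      then show ?thesis by (simp only: of_real_eq_iff)
    qed
    then have "D t0 > 0" using sign[OF tJ] by simp
    \<comment> \<open>D is continuous without zeros on the interval N, so its positive sign at
      \<open>t0\<close> persists.\<close>
    have D_pos: "D s > 0" if s: "s \<in> N" for s
    proof (rule ccontr)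
      assume "\<not> D s > 0"
      have iv: "is_interval (D ` N)"
        using connected_continuous_image[OF D_cont N(2)] by (simp add: is_interval_connected_1)
      have "0 \<in> D ` N"
        by (rule mem_is_interval_1_I[OF iv, of "D s" "D t0"]) (use \<open>D t0 > 0\<close> \<open>\<not> D s > 0\<close> N(3) s in auto)
      then show False using D_nz by force
    qed
    \<comment> \<open>Positivity removes the modulus from the invariance of the density:
      \<open>D s * \<nu> s = \<nu> (\<theta> s)\<close>, so \<theta> preserves arc length up to a
      constant shift.\<close>
    have der0: "((\<lambda>s. S (\<theta> s) - S s) has_real_derivative 0) (at s)" if s: "s \<in> N" for s
    proof -
      have sJ: "s \<in> J" "\<theta> s \<in> J" using s N J1 \<theta>J1 by blast+
      have "D s * \<nu> s = \<nu> (\<theta> s)" using \<nu>_germ[OF D(1)[OF s] sJ] D_pos[OF s] by simp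
      then have "1 / \<nu> (\<theta> s) * D s - 1 / \<nu> s = 0"
        using \<nu>_pos[OF sJ(1)] \<nu>_pos[OF sJ(2)] D_pos[OF s] by (auto simp: field_simps)
      moreover have "((\<lambda>s. S (\<theta> s) - S s) has_real_derivative (1 / \<nu> (\<theta> s) * D s - 1 / \<nu> s)) (at s)"
        using DERIV_chain2[OF S[OF \<theta>J1[OF s]] D(2)[OF s]] S[of s] s N by (intro DERIV_diff) auto
      ultimately show ?thesis by simp
    qed
    have "continuous_on N (\<lambda>s. S (\<theta> s) - S s)"
      using der0 by (meson DERIV_isCont continuous_at_imp_continuous_on)
    then obtain q where "S (\<theta> s) - S s = q" if "s \<in> N" for s
      using DERIV_zero_connected_constant[OF N(2,1) finite.emptyI, of "\<lambda>s. S (\<theta> s) - S s"] der0 by auto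
    then have "S (\<theta> s) - S s = S (\<theta> t0) - S t0" using s N(3) by metis
    then show ?thesis
      using \<theta>J1[OF s] c\<theta>[OF s] unfolding \<theta>t0 S_t0 by (simp add: \<theta>_def)
  qed

  have "open (S ` N)"
    using N S_cont S_inj by (intro invariance_of_domain) (auto intro: continuous_on_subset inj_on_subset)
  moreover have "0 \<in> S ` N" using N(3) S_t0 by (metis imageI)
  ultimately obtain \<beta> where \<beta>: "\<beta> > 0" "ball 0 \<beta> \<subseteq> S ` N" by (meson open_contains_ball)
  \<comment> \<open>Sums u + v with |u| < \<delta> and v between 0 and \<delta> then stay below 2 *
    \<delta> < \<beta> in absolute value, where R inverts S.\<close>
  define \<delta> where "\<delta> = \<beta> / 3"
  have \<delta>: "\<delta> > 0" using \<beta> by (simp add: \<delta>_def)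
  have SR: "R u \<in> N \<and> S (R u) = u" if "\<bar>u\<bar> < \<beta>" for u
  proof -
    have "u \<in> S ` N" using that \<beta>(2) by (auto simp: subset_iff)
    then show ?thesis using RS N(4) by auto
  qed
  define e where "e u = c (R u)" for u
  define e' where "e' u = \<nu> (R u) *\<^sub>R c' (R u)" for u
  have R0: "R 0 = t0" using RS[OF J1(3)] S_t0 by simp
  have e0: "e 0 = c t0" by (simp add: e_def R0)
  have e_der: "(e has_vector_derivative e' u) (at u)" if "\<bar>u\<bar> < \<beta>" for u
  proof -
    have Ru: "R u \<in> N" "S (R u) = u" using SR[OF that] by auto
    have "(R has_vector_derivative \<nu> (R u)) (at u)"
      using R_der[of "R u"] Ru N(4) by (auto simp: has_real_derivative_iff_has_vector_derivative)
    from vector_diff_chain_at[OF this der] Ru N(5) show ?thesis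
      unfolding e_def e'_def by (auto simp: o_def)
  qed
  have cont: "continuous_on {-\<delta>..\<delta> + \<delta>} e"
    using \<delta> by (intro continuous_at_imp_continuous_on ballI has_vector_derivative_continuous[OF e_der])
      (auto simp: \<delta>_def abs_less_iff)
  have ne: "e \<delta> \<noteq> e 0"
  proof
    assume "e \<delta> = e 0"
    then have "R \<delta> = R 0" using inj_onD[OF c_inj] SR[of \<delta>] SR[of 0] \<delta> \<beta> N(5) by (auto simp: e_def \<delta>_def)
    then show False using SR[of \<delta>] SR[of 0] \<delta> by (auto simp: \<delta>_def)
  qed
  have small: "\<bar>u\<bar> < \<beta>" if "\<bar>u\<bar> < \<delta>" for u using that \<delta> by (simp add: \<delta>_def)
  have smallv: "R v \<in> N \<and> S (R v) = v" if "v \<in> {0..\<delta>}" for v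
    using that SR[of v] \<delta> by (auto simp: \<delta>_def)
  have NJ: "t \<in> J" if "t \<in> N" for t using that N J1 by blast
  obtain \<Psi> A' where A': "open A'" "e 0 \<in> A'" "\<Psi> holomorphic_on A'"
    and \<Psi>: "\<And>u. \<bar>u\<bar> < \<delta> \<Longrightarrow> e u \<in> A' \<Longrightarrow> \<Psi> (e u) * e' u = 1"
  proof (rule flow_imp_vector_field[OF \<delta> \<delta> r(1) cont ne, where e' = e' and T = "\<lambda>v. T (R v)" and M = "Suc n"])
    show "T (R v) (e u) = e (u + v)" if "v \<in> {0..\<delta>}" "\<bar>u\<bar> < \<delta>" for u v
    proof -
      have uv: "R u \<in> N" "S (R u) = u" "R v \<in> N" "S (R v) = v" using SR small smallv that by auto
      from trans[OF uv(3,1)] uv(2,4)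
      have *: "L (T (R v) (c (R u))) \<in> J1" "T (R v) (c (R u)) = c (L (T (R v) (c (R u))))"
        "S (L (T (R v) (c (R u)))) = u + v" by auto
      then show ?thesis using RS[OF *(1)] by (simp add: e_def)
    qed
    show "e u \<in> ball (e 0) r" if "\<bar>u\<bar> < \<delta>" for u
    proof -
      have "R u \<in> N" using SR[OF small[OF that]] by simp
      then show ?thesis using cNB[of "R u"] unfolding e0 B_def[symmetric] by (simp add: e_def)
    qed
    show "(e has_vector_derivative e' u) (at u)" if "\<bar>u\<bar> < \<delta>" for u using e_der[OF small[OF that]] .
    have RJ: "R v \<in> J" if "v \<in> {0..\<delta>}" for v using smallv[OF that] NJ by simp
    show "T (R v) holomorphic_on ball (e 0) r" if "v \<in> {0..\<delta>}" for v
      using T_hol[OF RJ[OF that]] unfolding e0 B_def[symmetric] .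
    show "norm (T (R v) z) \<le> Suc n" if "v \<in> {0..\<delta>}" "z \<in> ball (e 0) r" for v z
      using T_bound[OF RJ[OF that(1)], of z] that(2) unfolding e0 B_def[symmetric] .
  qed blast
  \<comment> \<open>The identity for \<Psi> is available only for arc lengths below \<delta>, so the
    parameter is restricted through L. There \<open>\<Psi> (c u) * c' u\<close> equals 1 / \<nu>
    u.\<close>
  define A2 where "A2 = A' \<inter> (W \<inter> L -` (N \<inter> S -` ball 0 \<delta>))"
  have "open (N \<inter> S -` ball 0 \<delta>)"
    using N S_cont by (intro continuous_open_preimage) (auto intro: continuous_on_subset)
  then have "open A2" unfolding A2_def using A'(1) by (intro open_Int[OF _ preimage_L_open])
  moreover have "c t0 \<in> A2" unfolding A2_def using A'(2) e0 c_mem t0 Lc N(3) S_t0 \<delta> by auto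
  moreover have "\<Psi> holomorphic_on A2" using A'(3) by (auto simp: A2_def intro: holomorphic_on_subset)
  moreover have *: "\<Psi> (c u) * c' u = of_real (1 / \<nu> u)" if "u \<in> I" "c u \<in> A2" for u
  proof -
    have u: "u \<in> N" "\<bar>S u\<bar> < \<delta>" "c u \<in> A'" using that Lc by (auto simp: A2_def)
    then have "R (S u) = u" using RS N by blast
    then have "\<Psi> (c u) * (\<nu> u *\<^sub>R c' u) = 1" using \<Psi>[OF u(2)] u(3) by (simp add: e_def e'_def)
    then show ?thesis using \<nu>_pos[OF NJ[OF u(1)]] by (simp add: scaleR_conv_of_real field_simps)
  qed
  moreover have "\<Psi> (c t0) \<noteq> 0" using *[OF t0 \<open>c t0 \<in> A2\<close>] \<nu>_pos[OF J(3)] by auto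
  moreover have "\<Psi> (c u) * c' u \<in> \<real>" if "u \<in> I" "c u \<in> A2" for u
    unfolding *[OF that] by (rule Reals_of_real)
  ultimately show ?thesis using t0 by (intro straight_if_real_along_arc)
qed

lemma homogeneous_imp_straight_point:
  assumes "I \<noteq> {}" and hom: "\<And>s t. s \<in> I \<Longrightarrow> t \<in> I \<Longrightarrow> \<exists>A g. open A \<and> c s \<in> A \<and> g holomorphic_on A \<and>
    inj_on g A \<and> g ` (\<gamma> \<inter> A) \<subseteq> \<gamma> \<and> g (c s) = c t"
  obtains s where "s \<in> I" "straight \<gamma> (c s)"
proof (rule ccontr)
  assume "\<not> thesis"
  then have ns: "\<not> straight \<gamma> (c s)" if "s \<in> I" for s using that \<open>\<And>s. s \<in> I \<Longrightarrow> straight \<gamma> (c s) \<Longrightarrow> thesis\<close> by blast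
  obtain x where x: "x \<in> I" using assms(1) by blast
  obtain \<rho> where \<rho>: "\<rho> > 0" "cball x \<rho> \<subseteq> I" using I x by (meson open_contains_cball)
  define K where "K = cball x \<rho>"
  have K: "K \<subseteq> I" "compact K" using \<rho> by (auto simp: K_def)
  \<comment> \<open>Half the radius keeps all targets and their limits in the interior of K.\<close>
  have Kint: "{x - \<rho> / 2..x + \<rho> / 2} \<subseteq> interior K"
    using \<rho>(1) by (auto simp: K_def interior_cball dist_real_def)
  \<comment> \<open>Signs are encoded as booleans, so that the index type of the Baire argument is
    countable.\<close>
  define sg where "sg b = (if b then 1 else - 1 :: real)" for b
  define F where "F i = {t \<in> {x - \<rho> / 2..x + \<rho> / 2}. \<exists>m g. admissible K x (fst i) (sg (snd i)) t m g}" for i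
  have closed: "closed (F i)" for i
    unfolding closed_sequential_limits
  proof clarify
    fix t l assume t: "\<forall>n. t n \<in> F i" "t \<longlonglongrightarrow> l"
    have l: "l \<in> {x - \<rho> / 2..x + \<rho> / 2}"
      by (rule closed_sequentially[OF closed_atLeastAtMost _ t(2)]) (use t(1) in \<open>auto simp: F_def\<close>)
    have "\<forall>n. \<exists>m g. admissible K x (fst i) (sg (snd i)) (t n) m g" using t(1) by (simp add: F_def)
    then obtain m g where mg: "\<And>n. admissible K x (fst i) (sg (snd i)) (t n) (m n) (g n)" by metis
    have "l \<in> I" using l Kint K interior_subset by blast
    then obtain m' g' where "admissible K x (fst i) (sg (snd i)) l m' g'"
      using admissible_limit[OF mg t(2) x _ K] by blast
    then show "l \<in> F i" using l unfolding F_def by blast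
  qed
  have cover: "{x - \<rho> / 2..x + \<rho> / 2} \<subseteq> (\<Union>i. F i)"
  proof
    fix t assume t: "t \<in> {x - \<rho> / 2..x + \<rho> / 2}"
    then have tK: "t \<in> interior K" "t \<in> I" using Kint K interior_subset by blast+
    obtain A g where A: "open A" "c x \<in> A" "g holomorphic_on A" "inj_on g A" "g ` (\<gamma> \<inter> A) \<subseteq> \<gamma>" "g (c x) = c t"
      using hom[OF x tK(2)] by blast
    obtain n \<epsilon> m where "\<epsilon> = 1 \<or> \<epsilon> = -1" "admissible K x n \<epsilon> t m g"
      using admissible_exists[OF x tK(1) K(1) A] .
    then have "t \<in> F (n, \<epsilon> = 1)" using t by (auto simp: F_def sg_def)
    then show "t \<in> (\<Union>i. F i)" by blast
  qed
  have "x - \<rho> / 2 < x + \<rho> / 2" using \<rho>(1) by simp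
  from Baire_interval[OF this closed cover] obtain i t0 e where e: "e > 0" "ball t0 e \<subseteq> F i" "ball t0 e \<subseteq> {x - \<rho> / 2..x + \<rho> / 2}" .
  then have "\<forall>t\<in>ball t0 e. \<exists>m g. admissible K x (fst i) (sg (snd i)) t m g" by (auto simp: F_def)
  then obtain \<mu> \<psi> where adm: "\<And>t. t \<in> ball t0 e \<Longrightarrow> admissible K x (fst i) (sg (snd i)) t (\<mu> t) (\<psi> t)"
    by metis
  have sub: "ball t0 e \<subseteq> I" using e(3) Kint K interior_subset by blast
  have "straight \<gamma> (c t0)"
  proof (rule translations_imp_straight[where \<eta> = "e / 4" and \<mu> = \<mu> and \<psi> = \<psi>])
    show "cball t0 (2 * (e / 4)) \<subseteq> I" using sub e(1) by (auto simp: subset_iff)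
    show "admissible K x (fst i) (sg (snd i)) t (\<mu> t) (\<psi> t)" if "t \<in> ball t0 (2 * (e / 4))" for t
      using that e(1) by (intro adm) auto
  qed (use e(1) x K ns in auto)
  moreover have "t0 \<in> I" using sub e(1) by auto
  ultimately show False using ns by blast
qed

end

section \<open>From slice charts to arcs, and the equivalence\<close>

text \<open>The parametrization is the inverse chart on the first axis, and \<open>L\<close> is the
  first coordinate of the chart, defined on all of U.\<close>

lemma smooth_curve_imp_parametrized_arc:
  assumes "smooth_curve \<gamma>" "p \<in> \<gamma>"
  obtains I c c' L W x where "parametrized_arc \<gamma> I c c' L W" "x \<in> I" "c x = p"
proof -
  obtain U V \<phi> where pU: "p \<in> U" and dif: "smooth_diffeomorphism U V \<phi>"
    and img: "\<phi> ` (U \<inter> \<gamma>) = V \<inter> \<real>"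
    using assms unfolding smooth_curve_def by blast
  define f where "f = inv_into U \<phi>"
  have UV: "open U" "open V" "bij_betw \<phi> U V" "smooth_on U \<phi>" "smooth_on V f"
    using dif by (auto simp: smooth_diffeomorphism_def f_def)
  have f\<phi>: "f (\<phi> z) = z" if "z \<in> U" for z using that UV(3) by (simp add: f_def bij_betw_inv_into_left)
  have \<phi>f: "\<phi> (f w) = w" "f w \<in> U" if "w \<in> V" for w
    using that UV(3) by (auto simp: f_def bij_betw_inv_into_right) (metis bij_betw_def inv_into_into)
  have f1: "Ck_on 1 V f" "Ck_on 1 U \<phi>" using UV(4,5) by (auto simp only: smooth_on_def)
  then have f_diff: "\<And>z. z \<in> V \<Longrightarrow> f differentiable (at z)" "\<And>z. z \<in> U \<Longrightarrow> \<phi> differentiable (at z)"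
    and f_cont: "continuous_on V (\<lambda>z. frechet_derivative f (at z) 1)" by auto
  define I where "I = {s. complex_of_real s \<in> V}"
  have I: "open I"
  proof -
    have "I = complex_of_real -` V" by (auto simp: I_def)
    then show ?thesis using UV(2) by (simp add: continuous_open_vimage continuous_of_real)
  qed
  have arc: "parametrized_arc \<gamma> I (\<lambda>s. f (of_real s)) (\<lambda>s. frechet_derivative f (at (of_real s)) 1) (\<lambda>z. Re (\<phi> z)) U"
  proof
    show "open I" by (rule I)
    show "open U" by (rule UV)
    show "((\<lambda>s. f (of_real s)) has_vector_derivative frechet_derivative f (at (of_real s)) 1) (at s)"
      if "s \<in> I" for s
    proof -
      have "(f has_derivative frechet_derivative f (at (of_real s))) (at (of_real s))"
        using that f_diff(1) by (simp add: I_def frechet_derivative_works)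
      moreover have "(complex_of_real has_vector_derivative 1) (at s)"
        using has_vector_derivative_of_real[of "\<lambda>x. x" 1 "at s"] by (simp add: has_vector_derivative_id[unfolded id_def])
      ultimately show ?thesis
        using vector_derivative_diff_chain_within[of complex_of_real 1 s UNIV f]
        by (auto simp: o_def intro: has_derivative_at_withinI)
    qed
    show "continuous_on I (\<lambda>s. frechet_derivative f (at (of_real s)) 1)"
      by (rule continuous_on_compose2[OF f_cont]) (auto simp: I_def intro!: continuous_intros)
    show "(\<lambda>z. Re (\<phi> z)) differentiable at z" if "z \<in> U" for z
      using f_diff(2)[OF that] bounded_linear.has_derivative[OF bounded_linear_Re]
      unfolding differentiable_def by blast
    show "Re (\<phi> (f (of_real s))) = s" if "s \<in> I" for s using that \<phi>f by (simp add: I_def)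
    show "(\<lambda>s. f (of_real s)) ` I = \<gamma> \<inter> U"
    proof (intro equalityI subsetI)
      fix y assume "y \<in> (\<lambda>s. f (of_real s)) ` I"
      then obtain s where s: "of_real s \<in> V" "y = f (of_real s)" by (auto simp: I_def)
      then have "of_real s \<in> \<phi> ` (U \<inter> \<gamma>)" unfolding img by auto
      then show "y \<in> \<gamma> \<inter> U" using s(2) f\<phi> by auto
    next
      fix y assume y: "y \<in> \<gamma> \<inter> U"
      then have "\<phi> y \<in> V \<inter> \<real>" using img by blast
      then obtain s where "\<phi> y = of_real s" "of_real s \<in> V" by (auto elim: Reals_cases)
      then show "y \<in> (\<lambda>s. f (of_real s)) ` I" using f\<phi>[of y] y by (auto simp: I_def image_iff intro!: bexI[of _ s])
    qed
  qed
  have "\<phi> p \<in> V \<inter> \<real>" using img pU assms(2) by blast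
  then obtain x where "\<phi> p = of_real x" "of_real x \<in> V" by (auto elim: Reals_cases)
  then have "x \<in> I" "f (of_real x) = p" using f\<phi>[OF pU] by (auto simp: I_def)
  with arc show ?thesis by (rule that)
qed

text \<open>Some point of an arc around p is straight; a symmetry taking that point to p makes p
  straight as well.\<close>

lemma homogeneous_imp_straight:
  assumes "smooth_curve \<gamma>" "locally_biholomorphically_homogeneous \<gamma>" "p \<in> \<gamma>"
  shows "straight \<gamma> p"
proof -
  have hom: "\<exists>U \<psi>. q \<in> U \<and> biholomorphism U (\<psi> ` U) \<psi> \<and> \<psi> ` (U \<inter> \<gamma>) = \<gamma> \<inter> \<psi> ` U \<and> \<psi> q = q'"
    if "q \<in> \<gamma>" "q' \<in> \<gamma>" for q q'
    using assms(2) that unfolding locally_biholomorphically_homogeneous_def by blast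
  obtain I c c' L W x where arc: "parametrized_arc \<gamma> I c c' L W" and x: "x \<in> I" "c x = p"
    using smooth_curve_imp_parametrized_arc[OF assms(1,3)] .
  interpret parametrized_arc \<gamma> I c c' L W by (rule arc)
  obtain s where s: "s \<in> I" "straight \<gamma> (c s)"
  proof (rule homogeneous_imp_straight_point)
    show "I \<noteq> {}" using x by auto
    fix s t assume "s \<in> I" "t \<in> I"
    then obtain U \<psi> where U: "c s \<in> U" "biholomorphism U (\<psi> ` U) \<psi>" "\<psi> ` (U \<inter> \<gamma>) = \<gamma> \<inter> \<psi> ` U" "\<psi> (c s) = c t"
      using hom c_mem by meson
    then show "\<exists>A g. open A \<and> c s \<in> A \<and> g holomorphic_on A \<and> inj_on g A \<and> g ` (\<gamma> \<inter> A) \<subseteq> \<gamma> \<and> g (c s) = c t"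
      by (intro exI[of _ U] exI[of _ \<psi>]) (auto simp: biholomorphism_def bij_betw_def Int_commute)
  qed
  obtain U \<psi> where "c s \<in> U" "biholomorphism U (\<psi> ` U) \<psi>" "\<psi> ` (U \<inter> \<gamma>) = \<gamma> \<inter> \<psi> ` U" "\<psi> (c s) = p"
    using hom[OF c_mem(1)[OF s(1)] assms(3)] by blast
  then show ?thesis using straight_image s(2) by blast
qed

theorem theorem1p1:
  fixes \<gamma> :: "complex set"
  assumes "smooth_curve \<gamma>"
  shows "locally_biholomorphically_homogeneous \<gamma> \<longleftrightarrow> real_analytic_curve \<gamma>"
proof
  assume "locally_biholomorphically_homogeneous \<gamma>"
  then show "real_analytic_curve \<gamma>"
    by (intro straight_imp_real_analytic_curve homogeneous_imp_straight assms)
next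
  assume "real_analytic_curve \<gamma>"
  then show "locally_biholomorphically_homogeneous \<gamma>"
    by (intro straight_imp_homogeneous real_analytic_curve_imp_straight)
qed

end
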